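(* Let $n\ge1$, $\hbar>0$ and $w\in\mathbb{C}^n$, and put $J_w(z,\overline z)=\frac{1}{2\hbar}(\overline{w}z-w\overline{z})$. Then for all $t\in\mathbb{R}$ the $\star^\hbar_{\mathrm{Wick}}$-exponential series $$\mathrm{Exp}(tJ_w)=\sum_{k=0}^\infty\frac{t^k}{k!}J_w^{\star k}=u_{tw}$$ converges unconditionally in the topology of $\mathcal{A}_\hbar$ (to $u_{tw}$), where $J_w^{\star k}$ denotes the $k$-th power of $J_w$ with respect to $\star^\hbar_{\mathrm{Wick}}$ and $u_w(z,\overline z)=\mathrm{e}^{-\frac{\overline{w}w}{4\hbar}}\mathrm{e}^{\frac1{2\hbar}(\overline{w}z-w\overline{z})}$.
   Context: Conventions: $\mathbb{N}=\{0,1,2,\dots\}$; $z=(z^1,\dots,z^n)$ are the standard holomorphic coordinates on $\mathbb{C}^n$; $\overline{w}z=\sum_k\overline{w}^kz^k$ etc.; multiindex notation is the usual componentwise one; $\sum_{N=0}^\infty$ with $N$ a multiindex means summation over $\mathbb{N}^n$ and $\sum_{I=0}^R$ summation over $I\in\mathbb{N}^n$ with $I\le R$. For $p\in\mathbb{C}^n$, $f\in C^\infty(\mathbb{C}^n)$, $m\in\mathbb{N}$, $\ell\in\{0,\dots,2^m-1\}$, $R,S\in\mathbb{N}^n$ define recursively, with values in $[0,+\infty]$, $$h^{p,\hbar}_{0,0,R,S}(f)=\sum_{N=0}^\infty\frac{(2\hbar)^{|R|+|S|+|N|}}{N!}\left|\frac{\partial^{|R|+|S|+|N|}f}{\partial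 z^R\partial\overline{z}^{N+S}}(p)\right|^2,$$ and for $m\ge1$ $$h^{p,\hbar}_{m,\ell,R,S}(f)=\sum_{N=0}^\infty\frac1{N!}\Big(\sum_{I=0}^R\sum_{J=0}^{N+S}\tbinom{R}{I}\tbinom{N+S}{J}h^{p,\hbar}_{m-1,\ell/2,I,J}(f)\Big)^2\quad(\ell\text{ even}),$$ $$h^{p,\hbar}_{m,\ell,R,S}(f)=\sum_{N=0}^\infty\frac1{N!}\Big(\sum_{I=0}^R\sum_{J=0}^{N+S}\tbinom{R}{I}\tbinom{N+S}{J}h^{p,\hbar}_{m-1,(\ell-1)/2,J,I}(f)\Big)^2\quad(\ell\text{ odd}).$$ Put $\|f\|^{p,\hbar}_{m,\ell,R,S}=\big(h^{p,\hbar}_{m,\ell,R,S}(f)\big)^{1/2^{m+1}}$ and $\widetilde{\mathcal{A}}_{p,\hbar}=\{f\in C^\infty(\mathbb{C}^n)\mid \|f\|^{p,\hbar}_{m,\ell,R,S}<\infty\text{ for all }m,\ell,R,S\}$. Define $\mathcal{A}_{p,\hbar}=\widetilde{\mathcal{A}}_{p,\hbar}/\{f\in C^\infty(\mathbb{C}^n)\mid \mathsf{j}^\infty_pf=0\}$ (quotient by the functions with vanishing $\infty$-jet at $p$), with the topology induced by all the seminorms; it is a Fréchet space. Every class has a unique real-analytic representative, so $\mathcal{A}_{p,\hbar}$ is identified with a subspace of $C^\omega(\mathbb{C}^n)$. The product $f\star^\hbar_{\mathrm{Wick}}g=\sum_{N=0}^\infty\frac{(2\hbar)^{|N|}}{N!}\frac{\partial^{|N|}f}{\partial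 z^N}\frac{\partial^{|N|}g}{\partial\overline{z}^N}$ converges absolutely in $\mathcal{A}_{p,\hbar}$ and makes it a Fréchet $^*$-algebra with complex conjugation as involution. As a Fréchet $^*$-algebra, $\mathcal{A}_{p,\hbar}$ does not depend on $p$ and is denoted $\mathcal{A}_\hbar$. *)

theory Defs
  imports "HOL-Analysis.Analysis"
begin

section \<open>Smooth functions and Wirtinger derivatives on complex n-space\<close>

primrec Ck_fun :: "nat \<Rightarrow> ('a::euclidean_space \<Rightarrow> 'b::real_normed_vector) \<Rightarrow> bool" where
  "Ck_fun 0 f \<longleftrightarrow> continuous_on UNIV f"
| "Ck_fun (Suc k) f \<longleftrightarrow> f differentiable_on UNIV \<and>
     (\<forall>b\<in>Basis. Ck_fun k (\<lambda>x. frechet_derivative f (at x) b))"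

definition smooth_fun :: "('a::euclidean_space \<Rightarrow> 'b::real_normed_vector) \<Rightarrow> bool" where
  "smooth_fun f \<longleftrightarrow> (\<forall>k. Ck_fun k f)"

text \<open>The Frechet derivative is the real one: \<^term>\<open>axis k 1\<close> and \<^term>\<open>axis k \<i>\<close> are the
  directions of the real coordinates x and y in z = x + i y (k-th component).\<close>

definition d_z :: "'n::finite \<Rightarrow> (complex^'n \<Rightarrow> complex) \<Rightarrow> complex^'n \<Rightarrow> complex" where
  "d_z k f x = (frechet_derivative f (at x) (axis k 1)
                - \<i> * frechet_derivative f (at x) (axis k \<i>)) / 2"

definition d_zbar :: "'n::finite \<Rightarrow> (complex^'n \<Rightarrow> complex) \<Rightarrow> complex^'n \<Rightarrow> complex" where
  "d_zbar k f x = (frechet_derivative f (at x) (axis k 1)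
                   + \<i> * frechet_derivative f (at x) (axis k \<i>)) / 2"

text \<open>Multiindices are functions \<^typ>\<open>'n \<Rightarrow> nat\<close>; the pointwise order on functions is the
  componentwise order of multiindices.\<close>

definition mi_size :: "('n::finite \<Rightarrow> nat) \<Rightarrow> nat" where
  "mi_size N = (\<Sum>k\<in>UNIV. N k)"

definition mi_fact :: "('n::finite \<Rightarrow> nat) \<Rightarrow> nat" where
  "mi_fact N = (\<Prod>k\<in>UNIV. fact (N k))"

definition mi_binom :: "('n::finite \<Rightarrow> nat) \<Rightarrow> ('n \<Rightarrow> nat) \<Rightarrow> nat" where
  "mi_binom N I = (\<Prod>k\<in>UNIV. N k choose I k)"

definition mi_add :: "('n \<Rightarrow> nat) \<Rightarrow> ('n \<Rightarrow> nat) \<Rightarrow> ('n \<Rightarrow> nat)" where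
  "mi_add M N = (\<lambda>k. M k + N k)"

text \<open>The index type carries no order, so an arbitrary enumeration fixes the order in which the
  partial derivatives are taken. For smooth functions the choice is irrelevant, since partial
  derivatives commute.\<close>

definition index_list :: "'n::finite list" where
  "index_list = (SOME ks. distinct ks \<and> set ks = UNIV)"

definition mixed_deriv ::
  "('n::finite \<Rightarrow> nat) \<Rightarrow> ('n \<Rightarrow> nat) \<Rightarrow> (complex^'n \<Rightarrow> complex) \<Rightarrow> complex^'n \<Rightarrow> complex" where
  "mixed_deriv R S f =
     foldr (\<lambda>k. d_z k ^^ R k) index_list (foldr (\<lambda>k. d_zbar k ^^ S k) index_list f)"

text \<open>Real analyticity: locally a convergent power series in the 2n real coordinates.\<close>

definition real_analytic :: "(complex^'n::finite \<Rightarrow> complex) \<Rightarrow> bool" where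
  "real_analytic f \<longleftrightarrow>
     (\<forall>p. \<exists>r>0. \<exists>c :: ('n \<Rightarrow> nat) \<times> ('n \<Rightarrow> nat) \<Rightarrow> complex. \<forall>z\<in>ball p r.
        ((\<lambda>(A, B). c (A, B) * of_real (\<Prod>k\<in>UNIV. Re (z $ k - p $ k) ^ A k)
                            * of_real (\<Prod>k\<in>UNIV. Im (z $ k - p $ k) ^ B k)) has_sum f z) UNIV)"

section \<open>The seminorms and the spaces\<close>

primrec wick_h :: "complex^'n::finite \<Rightarrow> real \<Rightarrow> nat \<Rightarrow> nat \<Rightarrow> ('n \<Rightarrow> nat) \<Rightarrow> ('n \<Rightarrow> nat)
                     \<Rightarrow> (complex^'n \<Rightarrow> complex) \<Rightarrow> ennreal" where
  "wick_h p hbar 0 l R S f =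
     (\<Sum>\<^sub>\<infinity>N::'n \<Rightarrow> nat.
        ennreal ((2 * hbar) ^ (mi_size R + mi_size S + mi_size N) / real (mi_fact N)
                 * (cmod (mixed_deriv R (mi_add N S) f p))\<^sup>2))"
| "wick_h p hbar (Suc m) l R S f =
     (if even l then
        (\<Sum>\<^sub>\<infinity>N::'n \<Rightarrow> nat. ennreal (1 / real (mi_fact N)) *
           (\<Sum>I\<in>{..R}. \<Sum>J\<in>{..mi_add N S}.
              of_nat (mi_binom R I * mi_binom (mi_add N S) J) * wick_h p hbar m (l div 2) I J f)\<^sup>2)
      else
        (\<Sum>\<^sub>\<infinity>N::'n \<Rightarrow> nat. ennreal (1 / real (mi_fact N)) *
           (\<Sum>I\<in>{..R}. \<Sum>J\<in>{..mi_add N S}.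
              of_nat (mi_binom R I * mi_binom (mi_add N S) J)
                * wick_h p hbar m ((l - 1) div 2) J I f)\<^sup>2))"

definition wick_norm :: "complex^'n::finite \<Rightarrow> real \<Rightarrow> nat \<Rightarrow> nat \<Rightarrow> ('n \<Rightarrow> nat) \<Rightarrow> ('n \<Rightarrow> nat)
                     \<Rightarrow> (complex^'n \<Rightarrow> complex) \<Rightarrow> ennreal" where
  "wick_norm p hbar m l R S f =
     (if wick_h p hbar m l R S f = \<infinity> then \<infinity>
      else ennreal (enn2real (wick_h p hbar m l R S f) powr (1 / 2 ^ (m + 1))))"

definition wick_pre :: "complex^'n::finite \<Rightarrow> real \<Rightarrow> (complex^'n \<Rightarrow> complex) set" where
  "wick_pre p hbar =
     {f. smooth_fun f \<and> (\<forall>m. \<forall>l<2 ^ m. \<forall>R S. wick_norm p hbar m l R S f < \<infinity>)}"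

definition jet_null :: "complex^'n::finite \<Rightarrow> (complex^'n \<Rightarrow> complex) set" where
  "jet_null p = {f. smooth_fun f \<and> (\<forall>R S. mixed_deriv R S f p = 0)}"

definition wick_rel ::
  "complex^'n::finite \<Rightarrow> real \<Rightarrow> ((complex^'n \<Rightarrow> complex) \<times> (complex^'n \<Rightarrow> complex)) set" where
  "wick_rel p hbar = {(f, g). f \<in> wick_pre p hbar \<and> g \<in> wick_pre p hbar
                              \<and> (\<lambda>z. g z - f z) \<in> jet_null p}"

definition wick_quot :: "complex^'n::finite \<Rightarrow> real \<Rightarrow> (complex^'n \<Rightarrow> complex) set set" where
  "wick_quot p hbar = wick_pre p hbar // wick_rel p hbar"

text \<open>Distance of two classes in a seminorm. The seminorms depend only on the jet at p, so the
  infimum is over a set with a single element.\<close>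

definition wick_dist :: "complex^'n::finite \<Rightarrow> real \<Rightarrow> nat \<Rightarrow> nat \<Rightarrow> ('n \<Rightarrow> nat) \<Rightarrow> ('n \<Rightarrow> nat)
       \<Rightarrow> (complex^'n \<Rightarrow> complex) set \<Rightarrow> (complex^'n \<Rightarrow> complex) set \<Rightarrow> ennreal" where
  "wick_dist p hbar m l R S X Y = (INF f\<in>X. INF g\<in>Y. wick_norm p hbar m l R S (\<lambda>z. f z - g z))"

definition wick_ball :: "complex^'n::finite \<Rightarrow> real \<Rightarrow> (nat \<times> nat \<times> ('n \<Rightarrow> nat) \<times> ('n \<Rightarrow> nat)) set
       \<Rightarrow> real \<Rightarrow> (complex^'n \<Rightarrow> complex) set \<Rightarrow> (complex^'n \<Rightarrow> complex) set set" where
  "wick_ball p hbar F \<epsilon> X =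
     {Y \<in> wick_quot p hbar. \<forall>(m, l, R, S)\<in>F. wick_dist p hbar m l R S Y X < ennreal \<epsilon>}"

text \<open>The locally convex topology of the family of seminorms on the quotient: the finite
  intersections of open seminorm balls are the basic neighbourhoods.\<close>

definition wick_open :: "complex^'n::finite \<Rightarrow> real \<Rightarrow> (complex^'n \<Rightarrow> complex) set set \<Rightarrow> bool" where
  "wick_open p hbar U \<longleftrightarrow> U \<subseteq> wick_quot p hbar \<and>
     (\<forall>X\<in>U. \<exists>\<epsilon>>0. \<exists>F. finite F \<and> (\<forall>(m, l, R, S)\<in>F. l < 2 ^ m) \<and> wick_ball p hbar F \<epsilon> X \<subseteq> U)"

lemma wick_ball_mono:
  assumes "F \<subseteq> G" "d \<le> e"
  shows "wick_ball p hbar G d X \<subseteq> wick_ball p hbar F e X"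
proof -
  have "x < ennreal e" if "x < ennreal d" for x
    using less_le_trans[OF that ennreal_leI[OF assms(2)]] .
  then show ?thesis
    using assms(1) unfolding wick_ball_def split_beta by blast
qed

lemma istopology_wick_open: "istopology (wick_open p hbar)"
  unfolding istopology_def
proof (intro conjI allI impI)
  fix U V
  assume U: "wick_open p hbar U" and V: "wick_open p hbar V"
  show "wick_open p hbar (U \<inter> V)"
    unfolding wick_open_def
  proof (intro conjI ballI)
    show "U \<inter> V \<subseteq> wick_quot p hbar" using U unfolding wick_open_def by blast
    fix X assume X: "X \<in> U \<inter> V"
    obtain e F where e: "e > 0" "finite F" "\<forall>(m, l, R, S)\<in>F. l < 2 ^ m" "wick_ball p hbar F e X \<subseteq> U"
      using U X unfolding wick_open_def by (elim conjE IntE) (drule (1) bspec, elim exE conjE, rule that)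
    obtain d G where d: "d > 0" "finite G" "\<forall>(m, l, R, S)\<in>G. l < 2 ^ m" "wick_ball p hbar G d X \<subseteq> V"
      using V X unfolding wick_open_def by (elim conjE IntE) (drule (1) bspec, elim exE conjE, rule that)
    show "\<exists>\<epsilon>>0. \<exists>F. finite F \<and> (\<forall>(m, l, R, S)\<in>F. l < 2 ^ m) \<and> wick_ball p hbar F \<epsilon> X \<subseteq> U \<inter> V"
    proof (intro exI conjI)
      show "min e d > 0" "finite (F \<union> G)" using e d by simp_all
      show "\<forall>(m, l, R, S)\<in>F \<union> G. l < 2 ^ m" using e(3) d(3) by (simp add: ball_Un)
      have "wick_ball p hbar (F \<union> G) (min e d) X \<subseteq> wick_ball p hbar F e X"
        and "wick_ball p hbar (F \<union> G) (min e d) X \<subseteq> wick_ball p hbar G d X"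
        by (rule wick_ball_mono; simp)+
      then show "wick_ball p hbar (F \<union> G) (min e d) X \<subseteq> U \<inter> V" using e(4) d(4) by (meson Int_greatest subset_trans)
    qed
  qed
next
  fix K assume K: "\<forall>U\<in>K. wick_open p hbar U"
  show "wick_open p hbar (\<Union>K)"
    unfolding wick_open_def
  proof (intro conjI ballI)
    show "\<Union>K \<subseteq> wick_quot p hbar" using K unfolding wick_open_def by blast
    fix X assume "X \<in> \<Union>K"
    then obtain U where U: "U \<in> K" "X \<in> U" by blast
    then have "wick_open p hbar U" using K by blast
    then obtain e F where e: "e > 0" "finite F" "\<forall>(m, l, R, S)\<in>F. l < 2 ^ m" "wick_ball p hbar F e X \<subseteq> U"
      using U(2) unfolding wick_open_def by (elim conjE) (drule (1) bspec, elim exE conjE, rule that)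
    show "\<exists>\<epsilon>>0. \<exists>F. finite F \<and> (\<forall>(m, l, R, S)\<in>F. l < 2 ^ m) \<and> wick_ball p hbar F \<epsilon> X \<subseteq> \<Union>K"
    proof (intro exI conjI)
      show "wick_ball p hbar F e X \<subseteq> \<Union>K" using e(4) U(1) by (meson Union_upper subset_trans)
    qed (fact e)+
  qed
qed

definition wick_quot_topology ::
  "complex^'n::finite \<Rightarrow> real \<Rightarrow> (complex^'n \<Rightarrow> complex) set topology" where
  "wick_quot_topology p hbar = topology (wick_open p hbar)"

lemma openin_wick_quot_topology: "openin (wick_quot_topology p hbar) = wick_open p hbar"
  unfolding wick_quot_topology_def by (rule topology_inverse'[OF istopology_wick_open])

text \<open>Every class has exactly one real-analytic representative. The algebra is the set of these
  representatives, with the topology transported from the quotient.\<close>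

definition wick_algebra :: "complex^'n::finite \<Rightarrow> real \<Rightarrow> (complex^'n \<Rightarrow> complex) set" where
  "wick_algebra p hbar = {f \<in> wick_pre p hbar. real_analytic f}"

definition wick_topology :: "complex^'n::finite \<Rightarrow> real \<Rightarrow> (complex^'n \<Rightarrow> complex) topology" where
  "wick_topology p hbar =
     pullback_topology (wick_algebra p hbar) (\<lambda>f. wick_rel p hbar `` {f}) (wick_quot_topology p hbar)"

section \<open>The Wick star product\<close>

definition wick_star :: "real \<Rightarrow> (complex^'n::finite \<Rightarrow> complex) \<Rightarrow> (complex^'n \<Rightarrow> complex)
                           \<Rightarrow> complex^'n \<Rightarrow> complex" where
  "wick_star hbar f g z =
     (\<Sum>\<^sub>\<infinity>N::'n \<Rightarrow> nat. of_real ((2 * hbar) ^ mi_size N / real (mi_fact N))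
        * mixed_deriv N (\<lambda>_. 0) f z * mixed_deriv (\<lambda>_. 0) N g z)"

primrec wick_power :: "real \<Rightarrow> (complex^'n::finite \<Rightarrow> complex) \<Rightarrow> nat \<Rightarrow> complex^'n \<Rightarrow> complex" where
  "wick_power hbar f 0 = (\<lambda>z. 1)"
| "wick_power hbar f (Suc k) = wick_star hbar f (wick_power hbar f k)"

definition cdot :: "complex^'n::finite \<Rightarrow> complex^'n \<Rightarrow> complex" where
  "cdot a b = (\<Sum>k\<in>UNIV. cnj (a $ k) * b $ k)"

definition wick_J :: "real \<Rightarrow> complex^'n::finite \<Rightarrow> complex^'n \<Rightarrow> complex" where
  "wick_J hbar w z = (1 / (2 * of_real hbar)) * (cdot w z - cdot z w)"

definition wick_u :: "real \<Rightarrow> complex^'n::finite \<Rightarrow> complex^'n \<Rightarrow> complex" where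
  "wick_u hbar w z = exp (- (cdot w w / (4 * of_real hbar)))
                     * exp ((1 / (2 * of_real hbar)) * (cdot w z - cdot z w))"

end

theory Submission
  imports Defs "HOL-Complex_Analysis.Cauchy_Integral_Formula"
begin

text \<open>Since \<open>J\<close> is real-linear with constant Wirtinger derivatives, \<open>J \<star> g(J) = (x g - a g')(J)\<close> with
  \<open>a = |w|\<^sup>2 / 2\<hbar>\<close>, so the star powers of \<open>J\<close> are Hermite polynomials in \<open>J\<close>, and the exponential series
  is their generating function \<open>exp (t x - a t\<^sup>2 / 2)\<close> at \<open>x = J\<close>.
  For convergence it suffices to control jets at \<open>p\<close>: if all derivatives of order \<open>d\<close> at \<open>p\<close> are bounded by
  \<open>C r\<^sup>d\<close>, then by induction on \<open>m\<close> (binomial theorem and exponential series)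
  \<open>h\<^sub>m \<le> C^2^(m+1) K x^(|R|+|S|)\<close> with \<open>K\<close> and \<open>x\<close> independent of the function.
  The remainder of the generating function satisfies such a bound with a fixed \<open>r\<close> and \<open>C \<rightarrow> 0\<close>.\<close>

section \<open>Entire functions of exponential growth and their Taylor series\<close>

text \<open>A finite product of absolutely convergent exponential series may be multiplied out. The
  nonnegative sum is the majorant for the multivariable Taylor series below.\<close>

lemma has_sum_prod_exp:
  fixes u :: "'i \<Rightarrow> real"
  assumes "finite I" "\<And>i. i \<in> I \<Longrightarrow> 0 \<le> u i"
  shows "((\<lambda>A. \<Prod>i\<in>I. u i ^ A i / fact (A i)) has_sum exp (\<Sum>i\<in>I. u i)) (PiE I (\<lambda>_. UNIV))"
proof -
  let ?g = "\<lambda>i n. u i ^ n / fact n"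
  have *: "(?g i has_sum exp (u i)) UNIV" if "i \<in> I" for i
    using assms(2)[OF that] exp_converges[of "u i"]
    by (intro sums_nonneg_imp_has_sum) (auto simp: divide_inverse mult.commute)
  then have abs: "(\<lambda>n. norm (?g i n)) summable_on UNIV" if "i \<in> I" for i
    using that assms(2) by (auto simp: has_sum_iff abs_mult)
  have "(\<lambda>A. norm (\<Prod>i\<in>I. ?g i (A i))) summable_on (PiE I (\<lambda>_. UNIV))"
    unfolding abs_summable_equivalent
    by (rule abs_summable_on_prod_PiE[OF assms(1), where B = "\<lambda>_. UNIV"]) (use abs in \<open>auto simp: abs_summable_equivalent[symmetric]\<close>)
  then have "(\<lambda>A. \<Prod>i\<in>I. ?g i (A i)) summable_on (PiE I (\<lambda>_. UNIV))"
    by (rule abs_summable_summable)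
  moreover have "infsum (\<lambda>A. \<Prod>i\<in>I. ?g i (A i)) (PiE I (\<lambda>_. UNIV)) = (\<Prod>i\<in>I. exp (u i))"
    using * by (subst infsum_prod_PiE_abs[OF assms(1) abs]) (auto simp: has_sum_iff)
  ultimately show ?thesis
    using assms(1) by (simp add: has_sum_iff exp_sum)
qed

text \<open>This evaluates the sums over the multiindex \<open>N\<close> in the recursive definition
  of the seminorms, once the summands are bounded geometrically in the size of
  \<open>N\<close>.\<close>

lemma has_sum_mi_exp:
  assumes "0 \<le> q"
  shows "((\<lambda>N::'n::finite \<Rightarrow> nat. q ^ mi_size N / real (mi_fact N)) has_sum exp (real CARD('n) * q)) UNIV"
  using has_sum_prod_exp[of "UNIV :: 'n set" "\<lambda>_. q"] assms
  by (simp add: mi_size_def mi_fact_def power_sum prod_dividef)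

text \<open>An entire function \<open>\<phi> 0\<close> bundled with all its derivatives
  \<open>\<phi> d\<close>. The growth constants may depend on the point; a geometric bound on all
  derivatives at a point is what the seminorms there require.\<close>

definition tower :: "(nat \<Rightarrow> complex \<Rightarrow> complex) \<Rightarrow> bool" where
  "tower \<phi> \<longleftrightarrow> (\<forall>d x. (\<phi> d has_field_derivative \<phi> (Suc d) x) (at x)) \<and>
                (\<forall>x. \<exists>C\<ge>0. \<exists>r\<ge>0. \<forall>d. norm (\<phi> d x) \<le> C * r ^ d)"

lemma tower_deriv: "tower \<phi> \<Longrightarrow> (\<phi> d has_field_derivative \<phi> (Suc d) x) (at x)"
  by (simp add: tower_def)

lemma tower_bound: "tower \<phi> \<Longrightarrow> \<exists>C\<ge>0. \<exists>r\<ge>0. \<forall>d. norm (\<phi> d x) \<le> C * r ^ d"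
  by (simp add: tower_def)

lemma tower_zero: "tower (\<lambda>_ _. 0)"
  unfolding tower_def by (auto intro!: exI[of _ 0])

text \<open>An entire function equals its power series everywhere, and the geometric bound on the
  derivatives dominates that series by an exponential one, so it converges absolutely.\<close>

lemma tower_Taylor_1:
  assumes "tower \<phi>"
  shows "((\<lambda>a. \<phi> (k + a) y * (u ^ a / fact a)) has_sum \<phi> k (y + u)) UNIV"
proof -
  obtain C r where Cr: "0 \<le> C" "0 \<le> r" "\<And>d. norm (\<phi> d y) \<le> C * r ^ d"
    using tower_bound[OF assms, of y] by blast
  have der: "(deriv ^^ a) (\<phi> k) = \<phi> (k + a)" for a
    by (induction a) (auto intro!: DERIV_imp_deriv tower_deriv[OF assms])
  have "\<phi> k holomorphic_on ball y (norm u + 1)"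
    using tower_deriv[OF assms] unfolding holomorphic_on_def field_differentiable_def
    by (blast intro: has_field_derivative_at_within)
  then have "(\<lambda>a. (deriv ^^ a) (\<phi> k) y / fact a * (y + u - y) ^ a) sums \<phi> k (y + u)"
    by (rule holomorphic_power_series) (simp add: dist_norm)
  then have S: "(\<lambda>a. \<phi> (k + a) y * (u ^ a / fact a)) sums \<phi> k (y + u)"
    by (simp add: der)
  have "summable (\<lambda>a. C * r ^ k * ((r * norm u) ^ a /\<^sub>R fact a))"
    by (intro summable_mult summable_exp_generic)
  then have "summable (\<lambda>a. norm (\<phi> (k + a) y * (u ^ a / fact a)))"
  proof (rule summable_comparison_test[rotated], intro exI[of _ 0] allI impI)
    fix a :: nat
    have "norm (\<phi> (k + a) y * (u ^ a / fact a)) \<le> (C * r ^ (k + a)) * (norm u ^ a / fact a)"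
      unfolding norm_mult norm_divide norm_power by (intro mult_mono Cr(3)) (auto simp: Cr)
    then show "norm (norm (\<phi> (k + a) y * (u ^ a / fact a))) \<le> C * r ^ k * ((r * norm u) ^ a /\<^sub>R fact a)"
      by (simp add: power_add power_mult_distrib field_simps)
  qed
  from norm_summable_imp_has_sum[OF this S] show ?thesis .
qed

text \<open>Induction on the index set, splitting off one increment at a time. The order
  \<open>k\<close> is arbitrary because the inner sum for a fixed exponent \<open>a\<close> of the
  new increment is the induction hypothesis at order \<open>k + a\<close>.\<close>

lemma tower_Taylor:
  assumes "tower \<phi>" "finite I"
  shows "((\<lambda>A. \<phi> (k + (\<Sum>i\<in>I. A i)) y * (\<Prod>i\<in>I. u i ^ A i / fact (A i)))
           has_sum \<phi> k (y + (\<Sum>i\<in>I. u i))) (PiE I (\<lambda>_. UNIV))"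
  using assms(2)
proof (induction I arbitrary: k rule: finite_induct)
  case empty
  show ?case by (simp add: has_sum_finite_iff)
next
  case (insert j I)
  obtain C r where Cr: "0 \<le> C" "0 \<le> r" "\<And>d. norm (\<phi> d y) \<le> C * r ^ d"
    using tower_bound[OF assms(1), of y] by blast
  let ?P = "\<lambda>I. PiE I (\<lambda>_. UNIV :: nat set)"
  let ?T = "\<lambda>A. \<phi> (k + (\<Sum>i\<in>insert j I. A i)) y * (\<Prod>i\<in>insert j I. u i ^ A i / fact (A i))"
  let ?h = "\<lambda>(a, A). A(j := a)"
  have upd: "(\<Sum>i\<in>I. (A(j := a)) i) = (\<Sum>i\<in>I. A i)"
    "(\<Prod>i\<in>I. u i ^ (A(j := a)) i / fact ((A(j := a)) i)) = (\<Prod>i\<in>I. u i ^ A i / fact (A i))" for A a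
    using insert.hyps by (auto intro!: sum.cong prod.cong)
  have im: "?P (insert j I) = ?h ` (UNIV \<times> ?P I)"
    unfolding PiE_insert_eq by simp
  have inj: "inj_on ?h (UNIV \<times> ?P I)"
    using insert.hyps(2) by (intro inj_onI) (force simp: PiE_def extensional_def fun_eq_iff split: if_splits)
  \<comment> \<open>Joint summability over all exponents, needed to compute the sum iteratively,
    comes from the exponential majorant.\<close>
  have "(\<lambda>A. \<Prod>i\<in>insert j I. (r * norm (u i)) ^ A i / fact (A i)) summable_on ?P (insert j I)"
    using has_sum_prod_exp[of "insert j I" "\<lambda>i. r * norm (u i)"] insert.hyps Cr(2)
    by (auto simp: has_sum_iff)
  then have "(\<lambda>A. C * r ^ k * (\<Prod>i\<in>insert j I. (r * norm (u i)) ^ A i / fact (A i))) summable_on ?P (insert j I)"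
    by (rule summable_on_cmult_right)
  then have "(\<lambda>A. norm (?T A)) summable_on ?P (insert j I)"
  proof (rule summable_on_comparison_test)
    fix A
    have "norm (?T A) \<le> (C * r ^ (k + (\<Sum>i\<in>insert j I. A i))) * (\<Prod>i\<in>insert j I. norm (u i) ^ A i / fact (A i))"
      unfolding norm_mult prod_norm[symmetric]
      by (intro mult_mono Cr(3)) (auto simp: Cr norm_divide norm_power intro!: prod_nonneg mult_nonneg_nonneg)
    also have "\<dots> = C * r ^ k * (\<Prod>i\<in>insert j I. (r * norm (u i)) ^ A i / fact (A i))"
      by (simp only: power_add power_sum power_mult_distrib times_divide_eq_right[symmetric] prod.distrib mult.assoc)
    finally show "norm (?T A) \<le> C * r ^ k * (\<Prod>i\<in>insert j I. (r * norm (u i)) ^ A i / fact (A i))" .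
  qed auto
  then have "?T summable_on ?h ` (UNIV \<times> ?P I)"
    unfolding im[symmetric] by (rule abs_summable_summable)
  then have sumT: "(?T \<circ> ?h) summable_on (UNIV \<times> ?P I)"
    using summable_on_reindex[OF inj] by blast
  \<comment> \<open>Inner sum: induction hypothesis at base point \<open>y\<close>. Outer sum: the
    one-variable expansion by \<open>u j\<close> at the shifted base point.\<close>
  have "((?T \<circ> ?h) has_sum \<phi> k (y + (\<Sum>i\<in>I. u i) + u j)) (UNIV \<times> ?P I)"
  proof (rule has_sum_SigmaI[OF _ tower_Taylor_1[OF assms(1)] sumT])
    fix a :: nat
    have "(?T \<circ> ?h) (a, A) =
        \<phi> (k + a + (\<Sum>i\<in>I. A i)) y * (\<Prod>i\<in>I. u i ^ A i / fact (A i)) * (u j ^ a / fact a)" for A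
      by (simp only: o_def prod.case sum.insert[OF insert.hyps] prod.insert[OF insert.hyps] upd fun_upd_same)
         (simp only: mult_ac add_ac)
    then
    show "((\<lambda>A. (?T \<circ> ?h) (a, A)) has_sum \<phi> (k + a) (y + (\<Sum>i\<in>I. u i)) * (u j ^ a / fact a)) (?P I)"
      using has_sum_cmult_left[OF insert.IH[of "k + a"], of "u j ^ a / fact a"] by (simp only:)
  qed
  then show ?case
    unfolding im has_sum_reindex[OF inj] using insert.hyps by (simp add: add_ac)
qed

section \<open>Closure properties and basic examples of towers\<close>

lemma tower_cmult:
  assumes "tower \<phi>" shows "tower (\<lambda>d x. c * \<phi> d x)"
  unfolding tower_def
proof (intro conjI allI)
  fix d x
  show "((\<lambda>x. c * \<phi> d x) has_field_derivative c * \<phi> (Suc d) x) (at x)"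
    by (intro DERIV_cmult tower_deriv assms)
  obtain C r where Cr: "0 \<le> C" "0 \<le> r" "\<And>d. norm (\<phi> d x) \<le> C * r ^ d"
    using tower_bound[OF assms, of x] by blast
  then have "\<forall>d. norm (c * \<phi> d x) \<le> norm c * C * r ^ d"
    by (simp add: norm_mult mult.assoc mult_left_mono)
  moreover have "0 \<le> norm c * C" using Cr by simp
  ultimately show "\<exists>C\<ge>0. \<exists>r\<ge>0. \<forall>d. norm (c * \<phi> d x) \<le> C * r ^ d"
    using Cr(2) by blast
qed

lemma tower_add:
  assumes "tower \<phi>" "tower \<psi>" shows "tower (\<lambda>d x. \<phi> d x + \<psi> d x)"
  unfolding tower_def
proof (intro conjI allI)
  fix d x
  show "((\<lambda>x. \<phi> d x + \<psi> d x) has_field_derivative \<phi> (Suc d) x + \<psi> (Suc d) x) (at x)"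
    by (intro DERIV_add tower_deriv assms)
  obtain C r D s where C: "0 \<le> C" "0 \<le> r" "\<And>d. norm (\<phi> d x) \<le> C * r ^ d"
    and D: "0 \<le> D" "0 \<le> s" "\<And>d. norm (\<psi> d x) \<le> D * s ^ d"
    using tower_bound[OF assms(1), of x] tower_bound[OF assms(2), of x] by blast
  have "norm (\<phi> d x + \<psi> d x) \<le> (C + D) * max r s ^ d" for d
  proof -
    have "norm (\<phi> d x + \<psi> d x) \<le> C * r ^ d + D * s ^ d"
      by (rule norm_triangle_le) (intro add_mono C D)
    also have "\<dots> \<le> C * max r s ^ d + D * max r s ^ d"
      using C D by (intro add_mono mult_left_mono power_mono) auto
    finally show ?thesis by (simp add: distrib_right)
  qed
  moreover have "0 \<le> C + D" "0 \<le> max r s" using C D by auto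
  ultimately show "\<exists>C\<ge>0. \<exists>r\<ge>0. \<forall>d. norm (\<phi> d x + \<psi> d x) \<le> C * r ^ d"
    by blast
qed

lemma tower_sum:
  assumes "\<And>k. tower (\<phi> k)" shows "tower (\<lambda>d x. \<Sum>k\<in>F. \<phi> k d x)"
  by (induction F rule: infinite_finite_induct) (auto intro: tower_zero tower_add assms)

lemma tower_exp: "tower (\<lambda>d x. t ^ d * exp (t * x))"
  unfolding tower_def
proof (intro conjI allI)
  fix d x
  show "((\<lambda>x. t ^ d * exp (t * x)) has_field_derivative t ^ Suc d * exp (t * x)) (at x)"
    by (auto intro!: derivative_eq_intros)
  show "\<exists>C\<ge>0. \<exists>r\<ge>0. \<forall>d. norm (t ^ d * exp (t * x)) \<le> C * r ^ d"
    by (rule exI[of _ "norm (exp (t * x))"], rule conjI, simp, rule exI[of _ "norm t"])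
       (simp add: norm_mult norm_power mult.commute)
qed

text \<open>Presents a linear form itself as an entire function of that form, so that the general
  derivative formula also covers the left factor of the star product.\<close>

lemma tower_id: "tower (\<lambda>d x. if d = 0 then x else if d = 1 then 1 else 0)"
  unfolding tower_def
proof (intro conjI allI)
  fix d :: nat and x :: complex
  show "((\<lambda>x. if d = 0 then x else if d = 1 then 1 else 0) has_field_derivative
     (if Suc d = 0 then x else if Suc d = 1 then 1 else 0)) (at x)"
    by (auto intro!: derivative_eq_intros)
  show "\<exists>C\<ge>0. \<exists>r\<ge>0. \<forall>d. norm (if d = 0 then x else if d = 1 then 1 else 0) \<le> C * r ^ d"
    by (rule exI[of _ "norm x + 1"], rule conjI, simp, rule exI[of _ 1]) auto
qed

section \<open>Entire functions of a real-linear form\<close>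

lemma frechet_derivative_tower:
  assumes "tower \<phi>" "bounded_linear L"
  shows "((\<lambda>z. \<phi> d (L z) * c) has_derivative (\<lambda>h. \<phi> (Suc d) (L x) * L h * c)) (at x)"
    "frechet_derivative (\<lambda>z. \<phi> d (L z) * c) (at x) = (\<lambda>h. \<phi> (Suc d) (L x) * L h * c)"
proof -
  show *: "((\<lambda>z. \<phi> d (L z) * c) has_derivative (\<lambda>h. \<phi> (Suc d) (L x) * L h * c)) (at x)"
    by (intro has_derivative_mult_left has_derivative_compose[OF bounded_linear_imp_has_derivative[OF assms(2)]]
        has_field_derivative_imp_has_derivative tower_deriv[OF assms(1)])
  show "frechet_derivative (\<lambda>z. \<phi> d (L z) * c) (at x) = (\<lambda>h. \<phi> (Suc d) (L x) * L h * c)"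
    using frechet_derivative_at[OF *] by simp
qed

lemma smooth_tower:
  fixes L :: "'a::euclidean_space \<Rightarrow> complex"
  assumes "tower \<phi>" "bounded_linear L"
  shows "smooth_fun (\<lambda>z. \<phi> d (L z))"
proof -
  \<comment> \<open>The constant \<open>c\<close> makes the induction work: a directional derivative
    is again of this shape, with \<open>c\<close> multiplied by a value of \<open>L\<close>.\<close>
  have "Ck_fun k (\<lambda>z. \<phi> d (L z) * c)" for k d c
  proof (induction k arbitrary: d c)
    case 0
    show ?case
      using frechet_derivative_tower(1)[OF assms, of d c]
      by (auto simp: continuous_on_eq_continuous_at intro: has_derivative_continuous)
  next
    case (Suc k)
    have "(\<lambda>z. \<phi> d (L z) * c) differentiable_on UNIV"
      using frechet_derivative_tower(1)[OF assms, of d c]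
      by (auto simp: differentiable_on_def differentiable_def)
    then show ?case
      using Suc.IH[of "Suc d"] by (auto simp: frechet_derivative_tower(2)[OF assms] mult.assoc)
  qed
  from this[of _ d 1] show ?thesis by (simp add: smooth_fun_def)
qed

section \<open>Wirtinger derivatives of functions of a linear form\<close>

definition lin_z :: "(complex^'n::finite \<Rightarrow> complex) \<Rightarrow> 'n \<Rightarrow> complex" where
  "lin_z L k = (L (axis k 1) - \<i> * L (axis k \<i>)) / 2"

definition lin_zbar :: "(complex^'n::finite \<Rightarrow> complex) \<Rightarrow> 'n \<Rightarrow> complex" where
  "lin_zbar L k = (L (axis k 1) + \<i> * L (axis k \<i>)) / 2"

lemma d_tower:
  assumes "tower \<phi>" "bounded_linear L"
  shows "d_z k (\<lambda>z. \<phi> d (L z) * c) = (\<lambda>z. \<phi> (Suc d) (L z) * (c * lin_z L k))"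
    and "d_zbar k (\<lambda>z. \<phi> d (L z) * c) = (\<lambda>z. \<phi> (Suc d) (L z) * (c * lin_zbar L k))"
  unfolding fun_eq_iff d_z_def d_zbar_def lin_z_def lin_zbar_def frechet_derivative_tower(2)[OF assms]
  by (simp_all add: field_simps)

lemma funpow_d_tower:
  assumes "tower \<phi>" "bounded_linear L"
  shows "(d_z k ^^ r) (\<lambda>z. \<phi> d (L z) * c) = (\<lambda>z. \<phi> (d + r) (L z) * (c * lin_z L k ^ r))"
    and "(d_zbar k ^^ r) (\<lambda>z. \<phi> d (L z) * c) = (\<lambda>z. \<phi> (d + r) (L z) * (c * lin_zbar L k ^ r))"
  by (induction r) (simp_all add: d_tower[OF assms], simp_all add: mult_ac)

lemma foldr_d_tower:
  assumes "tower \<phi>" "bounded_linear L"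
  shows "foldr (\<lambda>k. d_z k ^^ R k) ks (\<lambda>z. \<phi> d (L z) * c) =
           (\<lambda>z. \<phi> (d + sum_list (map R ks)) (L z) * (c * prod_list (map (\<lambda>k. lin_z L k ^ R k) ks)))"
    and "foldr (\<lambda>k. d_zbar k ^^ R k) ks (\<lambda>z. \<phi> d (L z) * c) =
           (\<lambda>z. \<phi> (d + sum_list (map R ks)) (L z) * (c * prod_list (map (\<lambda>k. lin_zbar L k ^ R k) ks)))"
  by (induction ks) (simp_all add: funpow_d_tower[OF assms], simp_all add: ac_simps)

lemma index_list: "distinct (index_list :: 'n::finite list)" "set (index_list :: 'n list) = UNIV"
proof -
  obtain ks :: "'n list" where "set ks = UNIV" "distinct ks"
    using finite_distinct_list[of "UNIV :: 'n set"] by auto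
  then have "\<exists>ks :: 'n list. distinct ks \<and> set ks = UNIV" by blast
  from someI_ex[OF this] show "distinct (index_list :: 'n list)" "set (index_list :: 'n list) = UNIV"
    unfolding index_list_def by auto
qed

text \<open>Each Wirtinger derivative raises the order of \<open>\<phi>\<close> by one and
  contributes a constant factor, so the result is independent of the enumeration
  \<open>index_list\<close>.\<close>

lemma mixed_deriv_tower:
  fixes L :: "complex^'n::finite \<Rightarrow> complex"
  assumes "tower \<phi>" "bounded_linear L"
  shows "mixed_deriv R S (\<lambda>z. \<phi> 0 (L z)) x =
    \<phi> (mi_size R + mi_size S) (L x) * ((\<Prod>k\<in>UNIV. lin_z L k ^ R k) * (\<Prod>k\<in>UNIV. lin_zbar L k ^ S k))"
proof -
  have "sum_list (map N index_list) = mi_size N" for N :: "'n \<Rightarrow> nat"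
    by (simp add: sum_list_distinct_conv_sum_set index_list mi_size_def)
  moreover have "prod_list (map g index_list) = (\<Prod>k\<in>UNIV. g k)" for g :: "'n \<Rightarrow> complex"
    using prod.distinct_set_conv_list[OF index_list(1), of g] by (simp add: index_list)
  ultimately show ?thesis
    using foldr_d_tower(2)[OF assms, of S index_list 0 1]
    by (simp add: mixed_deriv_def foldr_d_tower(1)[OF assms] ac_simps)
qed

text \<open>A crude common bound for all Wirtinger derivatives of \<open>L\<close>; it is absorbed
  into the growth rate.\<close>

definition lin_bound :: "(complex^'n::finite \<Rightarrow> complex) \<Rightarrow> real" where
  "lin_bound L = (\<Sum>k\<in>UNIV. norm (lin_z L k) + norm (lin_zbar L k))"

lemma lin_bound_nonneg: "0 \<le> lin_bound L"
  by (simp add: lin_bound_def sum_nonneg)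

lemma mixed_deriv_tower_bound:
  fixes L :: "complex^'n::finite \<Rightarrow> complex"
  assumes "tower \<phi>" "bounded_linear L" "\<And>d. norm (\<phi> d (L x)) \<le> C * r ^ d" "0 \<le> C" "0 \<le> r"
  shows "norm (mixed_deriv R S (\<lambda>z. \<phi> 0 (L z)) x) \<le> C * (r * lin_bound L) ^ (mi_size R + mi_size S)"
proof -
  have mem: "norm (lin_z L k) + norm (lin_zbar L k) \<le> lin_bound L" for k
    unfolding lin_bound_def by (rule member_le_sum) auto
  have le: "norm (lin_z L k) \<le> lin_bound L" "norm (lin_zbar L k) \<le> lin_bound L" for k
    by (rule order_trans[OF _ mem[of k]], simp)+
  have "(\<Prod>k\<in>UNIV. norm (lin_z L k) ^ R k) \<le> lin_bound L ^ mi_size R"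
    "(\<Prod>k\<in>UNIV. norm (lin_zbar L k) ^ S k) \<le> lin_bound L ^ mi_size S"
    unfolding mi_size_def power_sum by (intro prod_mono conjI power_mono le; simp)+
  then have "norm (mixed_deriv R S (\<lambda>z. \<phi> 0 (L z)) x)
      \<le> (C * r ^ (mi_size R + mi_size S)) * (lin_bound L ^ mi_size R * lin_bound L ^ mi_size S)"
    unfolding mixed_deriv_tower[OF assms(1,2)] norm_mult prod_norm[symmetric] norm_power
    using assms(3,4,5) lin_bound_nonneg[of L]
    by (intro mult_mono) (auto intro!: prod_nonneg mult_nonneg_nonneg zero_le_power)
  then show ?thesis
    by (simp add: power_add power_mult_distrib mult_ac)
qed

section \<open>Real analyticity in the 2n real coordinates\<close>

lemma linear_axis_expansion:
  fixes L :: "complex^'n::finite \<Rightarrow> complex"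
  assumes "bounded_linear L"
  shows "L z = (\<Sum>k\<in>UNIV. of_real (Re (z $ k)) * L (axis k 1)) + (\<Sum>k\<in>UNIV. of_real (Im (z $ k)) * L (axis k \<i>))"
proof -
  interpret bounded_linear L by fact
  have "z = (\<Sum>k\<in>UNIV. Re (z $ k) *\<^sub>R axis k 1 + Im (z $ k) *\<^sub>R axis k \<i>)"
    by (auto simp: vec_eq_iff complex_eq_iff axis_def if_distrib if_distribR sum.distrib cong: if_cong)
  then have "L z = L (\<Sum>k\<in>UNIV. Re (z $ k) *\<^sub>R axis k 1 + Im (z $ k) *\<^sub>R axis k \<i>)"
    by simp
  then show ?thesis
    by (simp only: sum add scaleR sum.distrib) (simp only: scaleR_conv_of_real)
qed

text \<open>\<open>L z\<close> differs from \<open>L p\<close> by a sum of 2n terms, one per real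
  coordinate, so \<open>tower_Taylor\<close> at \<open>L p\<close> is the required power series. It
  converges everywhere, and the radius is chosen to be 1.\<close>

lemma real_analytic_tower:
  fixes L :: "complex^'n::finite \<Rightarrow> complex"
  assumes "tower \<phi>" "bounded_linear L"
  shows "real_analytic (\<lambda>z. \<phi> 0 (L z))"
  unfolding real_analytic_def
proof (intro allI exI conjI ballI)
  fix p z :: "complex^'n"
  let ?v = "case_sum (\<lambda>k. L (axis k 1)) (\<lambda>k. L (axis k \<i>)) :: 'n + 'n \<Rightarrow> complex"
  let ?x = "case_sum (\<lambda>k. Re (z $ k - p $ k)) (\<lambda>k. Im (z $ k - p $ k)) :: 'n + 'n \<Rightarrow> real"
  let ?c = "\<lambda>(A, B). \<phi> (mi_size A + mi_size B) (L p) *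
     ((\<Prod>k\<in>UNIV. L (axis k 1) ^ A k / fact (A k)) * (\<Prod>k\<in>UNIV. L (axis k \<i>) ^ B k / fact (B k)))"
  have split: "(\<Sum>i\<in>UNIV. g i) = (\<Sum>k\<in>UNIV. g (Inl k)) + (\<Sum>k\<in>UNIV. g (Inr k))"
    "(\<Prod>i\<in>UNIV. h i) = (\<Prod>k\<in>UNIV. h (Inl k)) * (\<Prod>k\<in>UNIV. h (Inr k))"
    for g :: "'n + 'n \<Rightarrow> 'b::comm_monoid_add" and h :: "'n + 'n \<Rightarrow> 'd::comm_monoid_mult"
    unfolding UNIV_Plus_UNIV[symmetric] by (subst sum.Plus prod.Plus; simp)+
  interpret bounded_linear L by (rule assms)
  \<comment> \<open>The sum type \<open>'n + 'n\<close> indexes the real and imaginary parts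
    together; its multiindices correspond to the pairs \<open>(A, B)\<close>.\<close>
  have bij: "bij_betw (\<lambda>(A, B). case_sum A B) (UNIV :: (('n \<Rightarrow> nat) \<times> ('n \<Rightarrow> nat)) set) UNIV"
    by (rule bij_betwI[where g = "\<lambda>A. (A \<circ> Inl, A \<circ> Inr)"]) (auto simp: fun_eq_iff split: sum.split)
  have Lz: "L z = L p + (\<Sum>i\<in>UNIV. ?v i * of_real (?x i))"
    using linear_axis_expansion[OF assms(2), of "z - p"] by (simp add: split diff algebra_simps)
  have "((\<lambda>A. \<phi> (0 + (\<Sum>i\<in>UNIV. A i)) (L p) * (\<Prod>i\<in>UNIV. (?v i * of_real (?x i)) ^ A i / fact (A i)))
           has_sum \<phi> 0 (L p + (\<Sum>i\<in>UNIV. ?v i * of_real (?x i)))) UNIV"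
    using tower_Taylor[OF assms(1), of "UNIV :: ('n + 'n) set" 0 "L p"] by simp
  then show "((\<lambda>(A, B). ?c (A, B) * of_real (\<Prod>k\<in>UNIV. Re (z $ k - p $ k) ^ A k)
                  * of_real (\<Prod>k\<in>UNIV. Im (z $ k - p $ k) ^ B k)) has_sum \<phi> 0 (L z)) UNIV"
    unfolding Lz
    by (subst (asm) has_sum_reindex_bij_betw[OF bij, symmetric], elim has_sum_cong[THEN iffD1, rotated])
       (simp add: split_beta split mi_size_def power_mult_distrib prod.distrib prod_dividef mult_ac)
qed (rule zero_less_one)

section \<open>Bounds for the seminorms\<close>

text \<open>Carries a majorant from the reals over to \<open>ennreal\<close>: every finite partial
  sum is below \<open>s\<close>.\<close>

lemma infsum_ennreal_le:
  fixes g :: "'a \<Rightarrow> ennreal"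
  assumes "(f has_sum s) A" "\<And>x. x \<in> A \<Longrightarrow> 0 \<le> f x" "\<And>x. x \<in> A \<Longrightarrow> g x \<le> ennreal (f x)"
  shows "infsum g A \<le> ennreal s"
proof (rule infsum_le_finite_sums)
  fix F assume F: "finite F" "F \<subseteq> A"
  then have "sum g F \<le> (\<Sum>x\<in>F. ennreal (f x))"
    by (intro sum_mono assms(3)) auto
  also have "\<dots> = ennreal (sum f F)"
    using F assms(2) by (intro sum_ennreal) auto
  also have "\<dots> \<le> ennreal s"
    using finite_sum_le_has_sum[OF assms(1) F(1)] F assms(2) by (intro ennreal_leI) auto
  finally show "sum g F \<le> ennreal s" .
qed (simp add: nonneg_summable_on_complete)

lemma sum_mi_binom:
  fixes R :: "'n::finite \<Rightarrow> nat"
  shows "(\<Sum>I\<in>{..R}. real (mi_binom R I) * x ^ mi_size I) = (1 + x) ^ mi_size R"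
proof -
  have eq: "{..R} = PiE UNIV (\<lambda>k. {..R k})"
    by (auto simp: le_fun_def PiE_def Pi_def)
  have "(1 + x) ^ mi_size R = (\<Prod>k\<in>UNIV. \<Sum>i\<le>R k. real (R k choose i) * x ^ i)"
    unfolding mi_size_def power_sum by (subst add.commute, subst binomial_ring) simp
  also have "\<dots> = (\<Sum>I\<in>{..R}. real (mi_binom R I) * x ^ mi_size I)"
    unfolding eq by (subst prod_sum_PiE) (simp_all add: mi_binom_def mi_size_def power_sum prod.distrib)
  finally show "(\<Sum>I\<in>{..R}. real (mi_binom R I) * x ^ mi_size I) = (1 + x) ^ mi_size R" ..
qed

lemma mi_size_add: "mi_size (mi_add M N) = mi_size M + mi_size N"
  by (simp add: mi_size_def mi_add_def sum.distrib)

text \<open>By the binomial theorem, the double binomial sum turns the growth rate \<open>x\<close>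
  into \<open>1 + x\<close> and keeps the constant.\<close>

lemma sum_binom_bound:
  fixes h :: "('n::finite \<Rightarrow> nat) \<Rightarrow> ('n \<Rightarrow> nat) \<Rightarrow> ennreal"
  assumes "\<And>I J. h I J \<le> ennreal (C * x ^ (mi_size I + mi_size J))" "0 \<le> C" "0 \<le> x"
  shows "(\<Sum>I\<in>{..R}. \<Sum>J\<in>{..S}. of_nat (mi_binom R I * mi_binom S J) * h I J)
           \<le> ennreal (C * (1 + x) ^ (mi_size R + mi_size S))"
proof -
  have "(\<Sum>I\<in>{..R}. \<Sum>J\<in>{..S}. of_nat (mi_binom R I * mi_binom S J) * h I J)
      \<le> (\<Sum>I\<in>{..R}. \<Sum>J\<in>{..S}. ennreal (real (mi_binom R I * mi_binom S J) * (C * x ^ (mi_size I + mi_size J))))"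
    unfolding ennreal_of_nat_eq_real_of_nat
    by (intro sum_mono) (subst ennreal_mult, auto simp: assms intro!: mult_left_mono mult_nonneg_nonneg)
  also have "\<dots> = ennreal (\<Sum>I\<in>{..R}. \<Sum>J\<in>{..S}. real (mi_binom R I * mi_binom S J) * (C * x ^ (mi_size I + mi_size J)))"
    using assms(2,3) by (simp add: sum_ennreal sum_nonneg)
  also have "(\<Sum>I\<in>{..R}. \<Sum>J\<in>{..S}. real (mi_binom R I * mi_binom S J) * (C * x ^ (mi_size I + mi_size J)))
      = C * ((\<Sum>I\<in>{..R}. real (mi_binom R I) * x ^ mi_size I) * (\<Sum>J\<in>{..S}. real (mi_binom S J) * x ^ mi_size J))"
    unfolding sum_product by (simp add: sum_distrib_left power_add mult_ac)
  finally show ?thesis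
    by (simp add: sum_mi_binom power_add)
qed

text \<open>One step of the seminorm recursion: squaring sends the rate \<open>1 + x\<close> to its
  square and \<open>C\<close> to its square, and the sum over \<open>N\<close> adds an exponential
  factor. As \<open>h\<close> is arbitrary, both parities of \<open>l\<close> are covered.\<close>

lemma infsum_sq_binom_bound:
  fixes h :: "('n::finite \<Rightarrow> nat) \<Rightarrow> ('n \<Rightarrow> nat) \<Rightarrow> ennreal"
  assumes "\<And>I J. h I J \<le> ennreal (C * x ^ (mi_size I + mi_size J))" "0 \<le> C" "0 \<le> x"
  shows "(\<Sum>\<^sub>\<infinity>N::'n \<Rightarrow> nat. ennreal (1 / real (mi_fact N)) *
           (\<Sum>I\<in>{..R}. \<Sum>J\<in>{..mi_add N S}. of_nat (mi_binom R I * mi_binom (mi_add N S) J) * h I J)\<^sup>2)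
         \<le> ennreal (C\<^sup>2 * exp (real CARD('n) * (1 + x)\<^sup>2) * ((1 + x)\<^sup>2) ^ (mi_size R + mi_size S))"
proof -
  let ?q = "(1 + x)\<^sup>2"
  have "((\<lambda>N::'n \<Rightarrow> nat. (C\<^sup>2 * ?q ^ (mi_size R + mi_size S)) * (?q ^ mi_size N / real (mi_fact N)))
      has_sum (C\<^sup>2 * ?q ^ (mi_size R + mi_size S)) * exp (real CARD('n) * ?q)) UNIV"
    by (intro has_sum_cmult_right has_sum_mi_exp) simp
  then have "(\<Sum>\<^sub>\<infinity>N::'n \<Rightarrow> nat. ennreal (1 / real (mi_fact N)) *
           (\<Sum>I\<in>{..R}. \<Sum>J\<in>{..mi_add N S}. of_nat (mi_binom R I * mi_binom (mi_add N S) J) * h I J)\<^sup>2)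
      \<le> ennreal ((C\<^sup>2 * ?q ^ (mi_size R + mi_size S)) * exp (real CARD('n) * ?q))"
  proof (rule infsum_ennreal_le)
    fix N :: "'n \<Rightarrow> nat"
    have "ennreal (1 / real (mi_fact N)) *
           (\<Sum>I\<in>{..R}. \<Sum>J\<in>{..mi_add N S}. of_nat (mi_binom R I * mi_binom (mi_add N S) J) * h I J)\<^sup>2
        \<le> ennreal (1 / real (mi_fact N)) * (ennreal (C * (1 + x) ^ (mi_size R + mi_size (mi_add N S))))\<^sup>2"
      by (intro mult_left_mono power_mono sum_binom_bound assms) auto
    also have "\<dots> = ennreal (1 / real (mi_fact N) * (C * (1 + x) ^ (mi_size R + mi_size (mi_add N S)))\<^sup>2)"
      using assms(2,3) by (subst ennreal_power, simp, subst ennreal_mult[symmetric]) simp_all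
    also have "1 / real (mi_fact N) * (C * (1 + x) ^ (mi_size R + mi_size (mi_add N S)))\<^sup>2 =
       (C\<^sup>2 * ?q ^ (mi_size R + mi_size S)) * (?q ^ mi_size N / real (mi_fact N))"
      by (simp add: mi_size_add power_mult_distrib power_add power2_eq_square)
    finally show "ennreal (1 / real (mi_fact N)) *
           (\<Sum>I\<in>{..R}. \<Sum>J\<in>{..mi_add N S}. of_nat (mi_binom R I * mi_binom (mi_add N S) J) * h I J)\<^sup>2
        \<le> ennreal ((C\<^sup>2 * ?q ^ (mi_size R + mi_size S)) * (?q ^ mi_size N / real (mi_fact N)))" .
  qed auto
  then show ?thesis by (simp add: mult_ac)
qed

text \<open>\<open>K\<close> and \<open>x\<close> are obtained before \<open>f\<close> and
  \<open>C\<close>. Hence a family of functions with a common rate \<open>r\<close> and constants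
  \<open>C\<close> tending to 0 tends to 0 in every seminorm.\<close>

lemma wick_h_bound:
  fixes p :: "complex^'n::finite"
  assumes "0 < hbar" "0 \<le> r"
  obtains K x where "0 \<le> K" "0 \<le> x"
    "\<And>f C R S. 0 \<le> C \<Longrightarrow> (\<And>R S. cmod (mixed_deriv R S f p) \<le> C * r ^ (mi_size R + mi_size S)) \<Longrightarrow>
       wick_h p hbar m l R S f \<le> ennreal (C ^ 2 ^ (m + 1) * K * x ^ (mi_size R + mi_size S))"
proof -
  have "\<exists>K\<ge>0. \<exists>x\<ge>0. \<forall>f C. 0 \<le> C \<longrightarrow> (\<forall>R S. cmod (mixed_deriv R S f p) \<le> C * r ^ (mi_size R + mi_size S)) \<longrightarrow>
      (\<forall>R S. wick_h p hbar m l R S f \<le> ennreal (C ^ 2 ^ (m + 1) * K * x ^ (mi_size R + mi_size S)))"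
  proof (induction m arbitrary: l)
    case 0
    let ?q = "2 * hbar * r\<^sup>2"
    show ?case
    proof (rule exI[of _ "exp (real CARD('n) * ?q)"], rule conjI[rotated], rule exI[of _ ?q], intro conjI allI impI)
      fix f C and R S :: "'n \<Rightarrow> nat"
      assume C: "0 \<le> C" and f: "\<forall>R S. cmod (mixed_deriv R S f p) \<le> C * r ^ (mi_size R + mi_size S)"
      have "((\<lambda>N::'n \<Rightarrow> nat. (C\<^sup>2 * ?q ^ (mi_size R + mi_size S)) * (?q ^ mi_size N / real (mi_fact N)))
          has_sum (C\<^sup>2 * ?q ^ (mi_size R + mi_size S)) * exp (real CARD('n) * ?q)) UNIV"
        using assms by (intro has_sum_cmult_right has_sum_mi_exp) simp
      then have "wick_h p hbar 0 l R S f \<le> ennreal ((C\<^sup>2 * ?q ^ (mi_size R + mi_size S)) * exp (real CARD('n) * ?q))"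
        unfolding wick_h.simps
      proof (rule infsum_ennreal_le)
        fix N :: "'n \<Rightarrow> nat"
        let ?s = "mi_size R + mi_size S + mi_size N"
        have "(2 * hbar) ^ ?s / real (mi_fact N) * (cmod (mixed_deriv R (mi_add N S) f p))\<^sup>2
            \<le> (2 * hbar) ^ ?s / real (mi_fact N) * (C * r ^ (mi_size R + mi_size (mi_add N S)))\<^sup>2"
          using assms f by (intro mult_left_mono power_mono) auto
        also have "\<dots> = (C\<^sup>2 * ?q ^ (mi_size R + mi_size S)) * (?q ^ mi_size N / real (mi_fact N))"
          by (simp add: mi_size_add power_mult_distrib power_add power2_eq_square)
        finally show "ennreal ((2 * hbar) ^ ?s / real (mi_fact N) * (cmod (mixed_deriv R (mi_add N S) f p))\<^sup>2)
            \<le> ennreal ((C\<^sup>2 * ?q ^ (mi_size R + mi_size S)) * (?q ^ mi_size N / real (mi_fact N)))"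
          by (rule ennreal_leI)
      qed (use assms in auto)
      then show "wick_h p hbar 0 l R S f
          \<le> ennreal (C ^ 2 ^ (0 + 1) * exp (real CARD('n) * ?q) * ?q ^ (mi_size R + mi_size S))"
        by (simp add: mult_ac)
    qed (use assms in auto)
  next
    case (Suc m)
    define l' where "l' = (if even l then l div 2 else (l - 1) div 2)"
    obtain K x where Kx: "0 \<le> K" "0 \<le> x" and IH:
      "\<And>f C R S. 0 \<le> C \<Longrightarrow> (\<forall>R S. cmod (mixed_deriv R S f p) \<le> C * r ^ (mi_size R + mi_size S)) \<Longrightarrow>
         wick_h p hbar m l' R S f \<le> ennreal (C ^ 2 ^ (m + 1) * K * x ^ (mi_size R + mi_size S))"
      using Suc.IH[of l'] by blast
    let ?K = "K\<^sup>2 * exp (real CARD('n) * (1 + x)\<^sup>2)"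
    show ?case
    proof (rule exI[of _ ?K], rule conjI[rotated], rule exI[of _ "(1 + x)\<^sup>2"], intro conjI allI impI)
      fix f C and R S :: "'n \<Rightarrow> nat"
      assume C: "0 \<le> C" and f: "\<forall>R S. cmod (mixed_deriv R S f p) \<le> C * r ^ (mi_size R + mi_size S)"
      define D where "D = C ^ 2 ^ (m + 1) * K"
      have D: "0 \<le> D" using C Kx by (simp add: D_def)
      have b: "wick_h p hbar m l' I J f \<le> ennreal (D * x ^ (mi_size I + mi_size J))" for I J
        unfolding D_def by (rule IH[OF C f])
      \<comment> \<open>The bound depends only on the sum of the two sizes, so the swap of
        \<open>I\<close> and \<open>J\<close> for odd \<open>l\<close> is harmless.\<close>
      have b': "wick_h p hbar m l' J I f \<le> ennreal (D * x ^ (mi_size I + mi_size J))" for I J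
        using b[of J I] by (simp add: add.commute)
      have "wick_h p hbar (Suc m) l R S f
          \<le> ennreal (D\<^sup>2 * exp (real CARD('n) * (1 + x)\<^sup>2) * ((1 + x)\<^sup>2) ^ (mi_size R + mi_size S))"
        using infsum_sq_binom_bound[of "\<lambda>I J. wick_h p hbar m l' I J f", OF b D Kx(2), of R S]
          infsum_sq_binom_bound[of "\<lambda>I J. wick_h p hbar m l' J I f", OF b' D Kx(2), of R S]
        by (simp add: l'_def split: if_splits)
      then show "wick_h p hbar (Suc m) l R S f
          \<le> ennreal (C ^ 2 ^ (Suc m + 1) * ?K * ((1 + x)\<^sup>2) ^ (mi_size R + mi_size S))"
        by (simp add: D_def power_mult_distrib power_mult[symmetric] mult_ac)
    qed (use Kx in auto)
  qed
  then show ?thesis using that by blast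
qed

section \<open>The generating function of the Hermite polynomials\<close>

text \<open>The Hermite polynomial of variance \<open>a\<close> divided by \<open>k!\<close>, i.e. the coefficient of \<open>t\<^sup>k\<close> in
  \<open>exp (t x - a t\<^sup>2 / 2)\<close>.\<close>

fun hermite :: "complex \<Rightarrow> nat \<Rightarrow> complex \<Rightarrow> complex" where
  "hermite a 0 x = 1"
| "hermite a (Suc 0) x = x"
| "hermite a (Suc (Suc k)) x = (x * hermite a (Suc k) x - a * hermite a k x) / of_nat (Suc (Suc k))"

text \<open>The three-term recurrence including \<open>k = 0\<close>, with the polynomial of index
  -1 read as 0.\<close>

lemma hermite_Suc:
  "of_nat (Suc k) * hermite a (Suc k) x = x * hermite a k x - a * (if k = 0 then 0 else hermite a (k - 1) x)"
  by (cases k) (simp_all del: of_nat_Suc)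

text \<open>With the normalisation by \<open>k!\<close>, differentiation merely lowers the index.
  The proof differentiates the recurrence.\<close>

lemma hermite_deriv:
  "(hermite a k has_field_derivative (if k = 0 then 0 else hermite a (k - 1) x)) (at x)"
proof (induction a k x rule: hermite.induct)
  case (1 a x)
  have "hermite a 0 = (\<lambda>_. 1)" by auto
  then show ?case by simp
next
  case (2 a x)
  have "hermite a (Suc 0) = (\<lambda>x. x)" by auto
  then show ?case by simp
next
  case (3 a k x)
  have eq: "hermite a (Suc (Suc k)) = (\<lambda>x. (x * hermite a (Suc k) x - a * hermite a k x) / of_nat (Suc (Suc k)))"
    by auto
  let ?h' = "if k = 0 then 0 else hermite a (k - 1) x"
  \<comment> \<open>The recurrence one index lower collects the terms in \<open>x\<close> and
    \<open>a\<close> into \<open>Suc k\<close> copies of \<open>hermite a (Suc k) x\<close>; the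
    product rule supplies one more copy, which cancels the denominator.\<close>
  have "(x * hermite a k x + hermite a (Suc k) x - a * ?h') / of_nat (Suc (Suc k)) =
      (of_nat (Suc k) * hermite a (Suc k) x + hermite a (Suc k) x) / of_nat (Suc (Suc k))"
    unfolding hermite_Suc by (simp add: algebra_simps)
  also have "\<dots> = of_nat (Suc (Suc k)) * hermite a (Suc k) x / of_nat (Suc (Suc k))"
    by (simp only: of_nat_Suc[of "Suc k"] distrib_right mult_1 add.commute)
  also have "\<dots> = hermite a (Suc k) x"
    by (rule nonzero_mult_div_cancel_left) (simp only: of_nat_eq_0_iff nat.distinct not_False_eq_True)
  finally have val: "(x * hermite a k x + hermite a (Suc k) x - a * ?h') / of_nat (Suc (Suc k)) = hermite a (Suc k) x" .
  have "(hermite a (Suc (Suc k)) has_field_derivative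
      (x * hermite a k x + hermite a (Suc k) x - a * ?h') / of_nat (Suc (Suc k))) (at x)"
    unfolding eq
    using DERIV_cdivide[OF DERIV_diff[OF DERIV_mult[OF DERIV_ident 3(1)] DERIV_cmult[OF 3(2)]]]
    by (simp add: add.commute mult.commute del: of_nat_Suc hermite.simps)
  then show ?case unfolding val by (simp del: hermite.simps)
qed

text \<open>The \<open>d\<close>-th derivative of \<open>hermite a k\<close>. The case distinction
  is essential, as truncated subtraction would give the constant 1 for \<open>d > k\<close>.\<close>

definition hermite_tower :: "complex \<Rightarrow> nat \<Rightarrow> nat \<Rightarrow> complex \<Rightarrow> complex" where
  "hermite_tower a k d x = (if d \<le> k then hermite a (k - d) x else 0)"

lemma tower_hermite: "tower (hermite_tower a k)"
  unfolding tower_def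
proof (intro conjI allI)
  fix d x
  show "(hermite_tower a k d has_field_derivative hermite_tower a k (Suc d) x) (at x)"
  proof (cases "d \<le> k")
    case True
    then have "hermite_tower a k d = hermite a (k - d)"
      by (auto simp: hermite_tower_def)
    then show ?thesis
      using hermite_deriv[of a "k - d" x] True by (auto simp: hermite_tower_def split: if_splits)
  next
    case False
    then have "hermite_tower a k d = (\<lambda>_. 0)"
      by (auto simp: hermite_tower_def)
    then show ?thesis
      using False by (simp add: hermite_tower_def)
  qed
  have "norm (hermite_tower a k d x) \<le> (\<Sum>j\<le>k. norm (hermite a j x)) * 1 ^ d" for d
    using member_le_sum[of "k - d" "{..k}" "\<lambda>j. norm (hermite a j x)"]
    by (auto simp: hermite_tower_def sum_nonneg)
  moreover have "0 \<le> (\<Sum>j\<le>k. norm (hermite a j x))" by (simp add: sum_nonneg)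
  ultimately show "\<exists>C\<ge>0. \<exists>r\<ge>0. \<forall>d. norm (hermite_tower a k d x) \<le> C * r ^ d"
    by (meson zero_le_one)
qed

text \<open>The coefficients decay faster than any geometric sequence, because the recurrence
  divides by the index. Once the index exceeds \<open>K\<close>, that division outweighs the scaled
  recurrence coefficients, so a bound for the earlier terms persists.\<close>

lemma hermite_growth:
  assumes "0 \<le> T"
  obtains M where "0 \<le> M" "\<And>k. norm (hermite a k x) * T ^ k \<le> M"
proof -
  \<comment> \<open>\<open>1 \<le> K\<close> ensures that every index above \<open>K\<close> is at
    least 2, where the recurrence applies.\<close>
  obtain K :: nat where K: "1 \<le> K" "T * norm x + T\<^sup>2 * norm a \<le> real K"
    by (metis le_cases of_nat_1 of_nat_le_iff order_trans real_arch_simple)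
  define M where "M = (\<Sum>j\<le>K. norm (hermite a j x) * T ^ j)"
  have M: "0 \<le> M" using assms by (auto simp: M_def intro!: sum_nonneg)
  have "norm (hermite a k x) * T ^ k \<le> M" for k
  proof (induction k rule: less_induct)
    case (less k)
    show ?case
    proof (cases "k \<le> K")
      case True
      then show ?thesis
        unfolding M_def using assms by (intro member_le_sum) auto
    next
      case False
      then obtain j where j: "k = Suc (Suc j)"
        using K(1) by (metis One_nat_def Suc_le_D not0_implies_Suc not_less_eq_eq)
      let ?n = "real (Suc (Suc j))"
      have "norm (hermite a k x) * T ^ k = norm (x * hermite a (Suc j) x - a * hermite a j x) * T ^ k / ?n"
        by (simp add: j norm_divide del: of_nat_Suc)
      also have "\<dots> \<le> (norm x * norm (hermite a (Suc j) x) + norm a * norm (hermite a j x)) * T ^ k / ?n"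
        using assms by (intro divide_right_mono mult_right_mono) (auto intro: norm_triangle_le_diff simp: norm_mult)
      also have "\<dots> = ((T * norm x) * (norm (hermite a (Suc j) x) * T ^ Suc j) +
          (T\<^sup>2 * norm a) * (norm (hermite a j x) * T ^ j)) / ?n"
        by (simp add: j power2_eq_square algebra_simps)
      also have "\<dots> \<le> ((T * norm x) * M + (T\<^sup>2 * norm a) * M) / ?n"
        using less.IH[of "Suc j"] less.IH[of j] assms
        by (intro divide_right_mono add_mono mult_left_mono) (auto simp: j)
      also have "\<dots> = (T * norm x + T\<^sup>2 * norm a) * M / ?n"
        by (simp add: distrib_right)
      also have "\<dots> \<le> ?n * M / ?n"
        using K(2) False M by (intro divide_right_mono mult_right_mono) (auto simp: j)
      finally show ?thesis by simp
    qed
  qed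
  with M that show ?thesis by blast
qed

lemma hermite_norm_summable: "summable (\<lambda>k. norm (hermite a k x * t ^ k))"
proof -
  \<comment> \<open>Doubling \<open>norm t\<close> leaves a spare factor \<open>(1 / 2) ^ k\<close>,
    which is summable.\<close>
  obtain M where M: "0 \<le> M" "\<And>k. norm (hermite a k x) * (2 * norm t) ^ k \<le> M"
    using hermite_growth[of "2 * norm t" a x] by auto
  have "summable (\<lambda>k. M * (1 / 2) ^ k)" by (intro summable_mult summable_geometric) simp
  then show ?thesis
  proof (rule summable_comparison_test[rotated], intro exI[of _ 0] allI impI)
    fix k
    show "norm (norm (hermite a k x * t ^ k)) \<le> M * (1 / 2) ^ k"
      using M(2)[of k] by (simp add: norm_mult norm_power power_mult_distrib power_divide field_simps)
  qed
qed

text \<open>The sum solves \<open>g' = (x - a t) g\<close>, \<open>g 0 = 1\<close>.\<close>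

lemma hermite_generating: "((\<lambda>k. hermite a k x * t ^ k) has_sum exp (t * x - a * t\<^sup>2 / 2)) UNIV"
proof -
  let ?c = "\<lambda>k. hermite a k x"
  define g where "g t = (\<Sum>k. ?c k * t ^ k)" for t
  have g: "(\<lambda>k. ?c k * t ^ k) sums g t" for t
    unfolding g_def by (rule summable_sums[OF summable_norm_cancel[OF hermite_norm_summable]])
  have g': "(g has_field_derivative (x - a * t) * g t) (at t)" for t
  proof -
    have "(\<lambda>k. x * (?c k * t ^ k)) sums (x * g t)"
      by (intro sums_mult g)
    moreover have "(\<lambda>k. if k = 0 then 0 else ?c (k - 1) * t ^ k) sums (t * g t)"
      using sums_Suc[of "\<lambda>k. if k = 0 then 0 else ?c (k - 1) * t ^ k" "t * g t"] sums_mult[OF g[of t], of t]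
      by (simp add: mult_ac)
    ultimately have "(\<lambda>k. x * (?c k * t ^ k) - a * (if k = 0 then 0 else ?c (k - 1) * t ^ k)) sums (x * g t - a * (t * g t))"
      by (rule sums_diff[OF _ sums_mult])
    \<comment> \<open>The coefficients of the derivative of the power series are the left-hand sides
      of \<open>hermite_Suc\<close>.\<close>
    moreover have "(\<lambda>k. x * (?c k * t ^ k) - a * (if k = 0 then 0 else ?c (k - 1) * t ^ k)) = (\<lambda>k. diffs ?c k * t ^ k)"
      unfolding diffs_def hermite_Suc by (auto simp: algebra_simps)
    ultimately have "(\<Sum>k. diffs ?c k * t ^ k) = (x - a * t) * g t"
      by (simp add: sums_iff algebra_simps)
    then show ?thesis
      using termdiffs_strong_converges_everywhere[of ?c t] g unfolding g_def
      by (simp add: sums_iff)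
  qed
  \<comment> \<open>Integrating factor: this product is constant, and its value at 0 is 1.\<close>
  have "((\<lambda>t. g t * exp (- (t * x - a * t\<^sup>2 / 2))) has_field_derivative 0) (at t)" for t
    by (auto intro!: derivative_eq_intros g' simp: algebra_simps)
  then obtain c where c: "\<And>t. g t * exp (- (t * x - a * t\<^sup>2 / 2)) = c"
    using has_field_derivative_zero_constant[of UNIV "\<lambda>t. g t * exp (- (t * x - a * t\<^sup>2 / 2))"] by auto
  have "g 0 = 1"
    using powser_zero[of ?c] by (simp add: g_def)
  then have "c = 1"
    using c[of 0] by simp
  then have "g t = exp (t * x - a * t\<^sup>2 / 2)"
    using c[of t] by (simp add: exp_minus field_simps)
  then show ?thesis
    using norm_summable_imp_has_sum[OF hermite_norm_summable g[of t]] by simp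
qed

section \<open>Truncation error of the generating function and its derivatives\<close>

lemma has_sum_geometric_half: "((\<lambda>k. (1 / 2) ^ k :: real) has_sum 2) UNIV"
  using geometric_sums[of "1 / 2 :: real"] by (intro sums_nonneg_imp_has_sum) auto

text \<open>The \<open>d\<close>-th derivative in \<open>x\<close> of the generating function,
  obtained by shifting the index by \<open>d\<close>; the terms with \<open>k < d\<close>
  vanish.\<close>

lemma hermite_tower_generating:
  "((\<lambda>k. t ^ k * hermite_tower a k d x) has_sum (t ^ d * exp (t * x - a * t\<^sup>2 / 2))) UNIV"
proof -
  have "((\<lambda>k. t ^ d * (hermite a k x * t ^ k)) has_sum (t ^ d * exp (t * x - a * t\<^sup>2 / 2))) UNIV"
    by (intro has_sum_cmult_right hermite_generating)
  then have "((\<lambda>k. t ^ k * hermite_tower a k d x) has_sum (t ^ d * exp (t * x - a * t\<^sup>2 / 2))) ((\<lambda>k. k + d) ` UNIV)"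
    by (subst has_sum_reindex) (auto simp: o_def hermite_tower_def power_add mult_ac)
  moreover have "range (\<lambda>k. k + d) = {d..}"
    by (auto simp: image_iff) (metis le_add_diff_inverse2)
  ultimately have "((\<lambda>k. t ^ k * hermite_tower a k d x) has_sum (t ^ d * exp (t * x - a * t\<^sup>2 / 2))) {d..}"
    by simp
  then show ?thesis
    by (rule has_sum_cong_neutral[THEN iffD1, rotated -1]) (auto simp: hermite_tower_def)
qed

text \<open>The error splits into a factor depending on \<open>F\<close> alone, namely the geometric
  mass outside \<open>F\<close>, and a factor geometric in \<open>d\<close>. \<open>F\<close> is any
  finite set, as unconditional convergence demands.\<close>

lemma hermite_remainder:
  obtains M where "0 \<le> M"
    "\<And>F d. finite F \<Longrightarrow> norm ((\<Sum>k\<in>F. t ^ k * hermite_tower a k d x) - t ^ d * exp (t * x - a * t\<^sup>2 / 2))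
        \<le> M * (2 - (\<Sum>k\<in>F. (1 / 2) ^ k)) * (2 * norm t) ^ d"
proof -
  obtain M where M: "0 \<le> M" "\<And>k. norm (hermite a k x) * (2 * norm t) ^ k \<le> M"
    using hermite_growth[of "2 * norm t" a x] by auto
  have "norm ((\<Sum>k\<in>F. t ^ k * hermite_tower a k d x) - t ^ d * exp (t * x - a * t\<^sup>2 / 2))
        \<le> M * (2 - (\<Sum>k\<in>F. (1 / 2) ^ k)) * (2 * norm t) ^ d" if F: "finite F" for F d
  proof -
    \<comment> \<open>The power of \<open>2 * norm t\<close> splits as \<open>j + d = k\<close>; the
      surplus powers of 2 are compensated by \<open>(1 / 2) ^ k\<close>.\<close>
    have term_le: "norm (t ^ k * hermite_tower a k d x) \<le> M * (2 * norm t) ^ d * (1 / 2) ^ k" for k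
    proof (cases "d \<le> k")
      case True
      then obtain j where j: "k = d + j" using le_Suc_ex by blast
      have "norm (t ^ k * hermite_tower a k d x) = (norm (hermite a j x) * (2 * norm t) ^ j) * ((2 * norm t) ^ d * (1 / 2) ^ k)"
        by (simp add: j hermite_tower_def norm_mult norm_power power_add power_mult_distrib power_divide)
      also have "\<dots> \<le> M * ((2 * norm t) ^ d * (1 / 2) ^ k)"
        by (intro mult_right_mono M) simp
      finally show ?thesis by (simp add: mult.assoc)
    qed (use M in \<open>simp add: hermite_tower_def\<close>)
    have "((\<lambda>k. t ^ k * hermite_tower a k d x) has_sum
        (t ^ d * exp (t * x - a * t\<^sup>2 / 2) - (\<Sum>k\<in>F. t ^ k * hermite_tower a k d x))) (UNIV - F)"
      by (intro has_sum_Diff hermite_tower_generating has_sum_finite F) auto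
    moreover have "((\<lambda>k. M * (2 * norm t) ^ d * (1 / 2) ^ k) has_sum
        M * (2 * norm t) ^ d * (2 - (\<Sum>k\<in>F. (1 / 2) ^ k))) (UNIV - F)"
      by (intro has_sum_cmult_right has_sum_Diff has_sum_geometric_half has_sum_finite F) auto
    ultimately have "norm (t ^ d * exp (t * x - a * t\<^sup>2 / 2) - (\<Sum>k\<in>F. t ^ k * hermite_tower a k d x))
        \<le> M * (2 * norm t) ^ d * (2 - (\<Sum>k\<in>F. (1 / 2) ^ k))"
      by (rule norm_infsum_le) (rule term_le)
    then show ?thesis
      by (subst norm_minus_commute) (simp add: mult_ac)
  qed
  with M that show ?thesis by blast
qed

section \<open>Star powers of a linear function\<close>

lemma mi_size_eq_0_iff: "mi_size N = 0 \<longleftrightarrow> N = (\<lambda>_. 0)"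
  by (auto simp: mi_size_def fun_eq_iff)

lemma mi_size_eq_1_iff: "mi_size N = 1 \<longleftrightarrow> (\<exists>k. N = (\<lambda>j. if j = k then 1 else 0))"
  unfolding mi_size_def sum_eq_1_iff[OF finite] by (auto simp: fun_eq_iff)

text \<open>Only the multiindices of size at most one contribute.\<close>

lemma wick_star_linear:
  fixes L :: "complex^'n::finite \<Rightarrow> complex"
  assumes "tower \<phi>" "bounded_linear L"
  shows "wick_star hbar L (\<lambda>z. \<phi> 0 (L z)) z =
    L z * \<phi> 0 (L z) + 2 * of_real hbar * (\<Sum>k\<in>UNIV. lin_z L k * lin_zbar L k) * \<phi> 1 (L z)"
proof -
  let ?\<psi> = "\<lambda>(d::nat) x. if d = 0 then x else if d = 1 then 1 else 0 :: complex"
  let ?e = "\<lambda>(k::'n) j. if j = k then 1 else 0 :: nat"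
  let ?T = "\<lambda>N. of_real ((2 * hbar) ^ mi_size N / real (mi_fact N))
        * mixed_deriv N (\<lambda>_. 0) L z * mixed_deriv (\<lambda>_. 0) N (\<lambda>z. \<phi> 0 (L z)) z"
  let ?A = "insert (\<lambda>_. 0) (range ?e) :: ('n \<Rightarrow> nat) set"
  have L: "mixed_deriv N (\<lambda>_. 0) L z = ?\<psi> (mi_size N) (L z) * (\<Prod>k\<in>UNIV. lin_z L k ^ N k)" for N
    using mixed_deriv_tower[OF tower_id assms(2), of N "\<lambda>_. 0" z] by (simp add: mi_size_def)
  have \<phi>: "mixed_deriv (\<lambda>_. 0) N (\<lambda>z. \<phi> 0 (L z)) z = \<phi> (mi_size N) (L z) * (\<Prod>k\<in>UNIV. lin_zbar L k ^ N k)" for N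
    using mixed_deriv_tower[OF assms, of "\<lambda>_. 0" N z] by (simp add: mi_size_def)
  have Te: "?T (?e k) = 2 * of_real hbar * (lin_z L k * lin_zbar L k) * \<phi> 1 (L z)" for k
  proof -
    have "mi_size (?e k) = 1" unfolding mi_size_eq_1_iff by blast
    moreover have "mi_fact (?e k) = 1"
      unfolding mi_fact_def by (rule prod.neutral) auto
    moreover have "(\<Prod>j\<in>UNIV. c j ^ ?e k j) = c k" for c :: "'n \<Rightarrow> complex"
      by (simp add: if_distrib cong: if_cong)
    ultimately show ?thesis by (simp add: L \<phi>)
  qed
  have "?T N = 0" if "N \<notin> ?A" for N
    using that mi_size_eq_0_iff[of N] mi_size_eq_1_iff[of N] by (auto simp: L)
  then have "wick_star hbar L (\<lambda>z. \<phi> 0 (L z)) z = infsum ?T ?A"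
    unfolding wick_star_def by (intro infsum_cong_neutral) auto
  also have "\<dots> = sum ?T ?A"
    by (intro infsum_finite) simp
  also have "\<dots> = ?T (\<lambda>_. 0) + (\<Sum>k\<in>UNIV. ?T (?e k))"
  proof -
    have "(\<lambda>_. 0) \<notin> range ?e" by (auto simp: fun_eq_iff) (metis zero_neq_one)
    moreover have "inj ?e" by (auto simp: inj_def fun_eq_iff)
    ultimately show ?thesis by (subst sum.insert) (simp_all add: sum.reindex)
  qed
  also have "?T (\<lambda>_. 0) = L z * \<phi> 0 (L z)"
    by (simp add: L \<phi> mi_size_def mi_fact_def)
  also have "(\<Sum>k\<in>UNIV. ?T (?e k)) = 2 * of_real hbar * (\<Sum>k\<in>UNIV. lin_z L k * lin_zbar L k) * \<phi> 1 (L z)"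
    unfolding Te by (simp add: sum_distrib_left sum_distrib_right)
  finally show ?thesis .
qed

section \<open>Star powers of J and the limit function\<close>

lemma bounded_linear_wick_J: "bounded_linear (wick_J hbar w)"
proof -
  have "linear (wick_J hbar w)"
    unfolding wick_J_def cdot_def
    by (rule linearI; unfold vector_scaleR_component vector_add_component)
       (simp_all add: algebra_simps sum.distrib scaleR_conv_of_real sum_distrib_left)
  then show ?thesis by (simp add: linear_conv_bounded_linear)
qed

lemma lin_wick_J:
  assumes "hbar \<noteq> 0"
  shows "lin_z (wick_J hbar w) k = cnj (w $ k) / (2 * of_real hbar)"
    and "lin_zbar (wick_J hbar w) k = - (w $ k) / (2 * of_real hbar)"
proof -
  have "cdot w (axis k c) = cnj (w $ k) * c" "cdot (axis k c) w = cnj c * w $ k" for c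
    by (simp_all add: cdot_def axis_def if_distrib if_distribR cong: if_cong)
  then show "lin_z (wick_J hbar w) k = cnj (w $ k) / (2 * of_real hbar)"
    "lin_zbar (wick_J hbar w) k = - (w $ k) / (2 * of_real hbar)"
    using assms by (simp_all add: lin_z_def lin_zbar_def wick_J_def field_simps)
qed

text \<open>Star multiplication by \<open>J\<close> sends \<open>\<phi>\<close> of \<open>J\<close>
  to x times \<open>\<phi>\<close> minus a times its derivative. Since the derivative lowers the
  Hermite index, this is the Hermite recurrence.\<close>

lemma wick_power_wick_J:
  assumes "hbar \<noteq> 0"
  shows "wick_power hbar (wick_J hbar w) k =
    (\<lambda>z. fact k * hermite (cdot w w / (2 * of_real hbar)) k (wick_J hbar w z))"
proof (induction k)
  case (Suc k)
  let ?a = "cdot w w / (2 * of_real hbar)" and ?J = "wick_J hbar w"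
  \<comment> \<open>Each product of the two Wirtinger derivatives is minus the squared modulus of
    \<open>w $ k\<close> over \<open>4 * hbar ^ 2\<close>, whence the sign.\<close>
  have a: "2 * of_real hbar * (\<Sum>k\<in>UNIV. lin_z ?J k * lin_zbar ?J k) = - ?a"
    unfolding lin_wick_J[OF assms] using assms
    by (simp add: cdot_def sum_negf sum_distrib_left sum_divide_distrib field_simps)
  have alg: "x * (fact k * hermite_tower b k 0 x) + (- b) * (fact k * hermite_tower b k 1 x)
      = fact k * (of_nat (Suc k) * hermite b (Suc k) x)" for b x
    unfolding hermite_Suc by (cases k) (simp_all add: hermite_tower_def algebra_simps)
  show ?case
  proof
    fix z
    have "wick_power hbar ?J (Suc k) z = wick_star hbar ?J (\<lambda>z. fact k * hermite_tower ?a k 0 (?J z)) z"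
      by (simp add: Suc.IH hermite_tower_def)
    also have "\<dots> = ?J z * (fact k * hermite_tower ?a k 0 (?J z)) + (- ?a) * (fact k * hermite_tower ?a k 1 (?J z))"
      using wick_star_linear[OF tower_cmult[OF tower_hermite] bounded_linear_wick_J, of hbar hbar w "fact k" ?a k z]
      unfolding a .
    also have "\<dots> = fact k * (of_nat (Suc k) * hermite ?a (Suc k) (?J z))"
      by (rule alg)
    finally show "wick_power hbar ?J (Suc k) z = fact (Suc k) * hermite ?a (Suc k) (?J z)"
      by (simp add: mult_ac del: hermite.simps)
  qed
qed simp

text \<open>Identifies the limit with the generating function at \<open>J\<close>: a real
  \<open>t\<close> passes through both slots of \<open>cdot\<close>.\<close>

lemma wick_u_eq:
  assumes "hbar \<noteq> 0"
  shows "wick_u hbar (t *\<^sub>R w) z =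
    exp (of_real t * wick_J hbar w z - cdot w w / (2 * of_real hbar) * (of_real t)\<^sup>2 / 2)"
proof -
  have "cdot (t *\<^sub>R w) (t *\<^sub>R w) = (of_real t)\<^sup>2 * cdot w w" "cdot (t *\<^sub>R w) z = of_real t * cdot w z"
    "cdot z (t *\<^sub>R w) = of_real t * cdot z w"
    unfolding cdot_def vector_scaleR_component
    by (simp_all add: sum_distrib_left scaleR_conv_of_real power2_eq_square mult_ac)
  then show ?thesis
    unfolding wick_u_def wick_J_def exp_add[symmetric]
    using assms by (intro arg_cong[of _ _ exp]) (simp add: field_simps)
qed

section \<open>Convergence in the Wick algebra\<close>

lemma wick_norm_less:
  assumes "wick_h p hbar m l R S f \<le> ennreal b" "0 \<le> b" "b < e ^ 2 ^ (m + 1)" "0 < e"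
  shows "wick_norm p hbar m l R S f < ennreal e"
proof -
  let ?h = "wick_h p hbar m l R S f" and ?q = "1 / 2 ^ (m + 1) :: real"
  have fin: "?h \<noteq> \<infinity>" using assms(1) by (auto simp: top_unique)
  have "enn2real ?h \<le> b" using assms(1,2) by (rule enn2real_leI[rotated])
  then have "enn2real ?h powr ?q < (e ^ 2 ^ (m + 1)) powr ?q"
    using assms(3) by (intro powr_less_mono2) auto
  also have "(e ^ 2 ^ (m + 1)) powr ?q = e"
    using assms(4) by (simp add: powr_realpow[symmetric] powr_powr)
  finally show ?thesis
    using fin assms(4) by (simp add: wick_norm_def ennreal_less_iff)
qed

text \<open>The growth bound at \<open>L p\<close> bounds the jet at \<open>p\<close> geometrically,
  so all seminorms are finite. Star powers, partial sums and the limit are all of this form.\<close>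

lemma tower_in_wick_algebra:
  fixes L :: "complex^'n::finite \<Rightarrow> complex"
  assumes "tower \<phi>" "bounded_linear L" "0 < hbar"
  shows "(\<lambda>z. \<phi> 0 (L z)) \<in> wick_algebra p hbar"
proof -
  obtain C r where Cr: "0 \<le> C" "0 \<le> r" "\<And>d. norm (\<phi> d (L p)) \<le> C * r ^ d"
    using tower_bound[OF assms(1), of "L p"] by blast
  have "wick_norm p hbar m l R S (\<lambda>z. \<phi> 0 (L z)) < \<infinity>" for m l R S
  proof -
    obtain K x where "wick_h p hbar m l R S (\<lambda>z. \<phi> 0 (L z))
        \<le> ennreal (C ^ 2 ^ (m + 1) * K * x ^ (mi_size R + mi_size S))"
      using wick_h_bound[OF assms(3), of "r * lin_bound L" p m l] mixed_deriv_tower_bound[OF assms(1,2) Cr(3,1,2)] Cr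
      by (metis lin_bound_nonneg mult_nonneg_nonneg)
    then have "wick_h p hbar m l R S (\<lambda>z. \<phi> 0 (L z)) \<noteq> \<infinity>"
      by (auto simp: top_unique)
    then show ?thesis by (simp add: wick_norm_def)
  qed
  then show ?thesis
    using smooth_tower[OF assms(1,2), of 0] real_analytic_tower[OF assms(1,2)]
    by (simp add: wick_algebra_def wick_pre_def)
qed

lemma wick_rel_refl:
  fixes p :: "complex^'n::finite"
  assumes "f \<in> wick_pre p hbar" shows "f \<in> wick_rel p hbar `` {f}"
proof -
  have "smooth_fun (\<lambda>z::complex^'n. 0 :: complex)" "mixed_deriv R S (\<lambda>z::complex^'n. 0) p = 0" for R S
    using smooth_tower[OF tower_zero bounded_linear_zero[where 'a = "complex^'n"]]
      mixed_deriv_tower[OF tower_zero bounded_linear_zero, of R S p] by simp_all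
  then show ?thesis
    using assms by (simp add: wick_rel_def jet_null_def)
qed

lemma wick_dist_le:
  assumes "f \<in> wick_pre p hbar" "g \<in> wick_pre p hbar"
  shows "wick_dist p hbar m l R S (wick_rel p hbar `` {f}) (wick_rel p hbar `` {g})
           \<le> wick_norm p hbar m l R S (\<lambda>z. f z - g z)"
  unfolding wick_dist_def
  by (rule INF_lower2[OF wick_rel_refl[OF assms(1)]], rule INF_lower2[OF wick_rel_refl[OF assms(2)]]) simp

text \<open>A neighbourhood of \<open>g\<close> contains the functions of the algebra whose classes
  lie in a ball given by finitely many seminorms; quotient distances are at most the seminorms of
  differences of representatives.\<close>

lemma limitin_wick_topologyI:
  assumes f: "\<And>i. f i \<in> wick_algebra p hbar" and g: "g \<in> wick_algebra p hbar"
    and lim: "\<And>m l R S e. l < 2 ^ m \<Longrightarrow> 0 < e \<Longrightarrow>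
       eventually (\<lambda>i. wick_norm p hbar m l R S (\<lambda>z. f i z - g z) < ennreal e) G"
  shows "limitin (wick_topology p hbar) f g G"
proof -
  let ?c = "\<lambda>f. wick_rel p hbar `` {f}"
  have pre: "f i \<in> wick_pre p hbar" "g \<in> wick_pre p hbar" for i
    using f g by (auto simp: wick_algebra_def)
  have quot: "?c (f i) \<in> wick_quot p hbar" "?c g \<in> wick_quot p hbar" for i
    using pre by (auto simp: wick_quot_def intro: quotientI)
  \<comment> \<open>The whole quotient is open, so the class of \<open>g\<close> lies in the
    topological space.\<close>
  have "openin (wick_quot_topology p hbar) (wick_quot p hbar)"
    unfolding openin_wick_quot_topology wick_open_def wick_ball_def
    by (auto intro!: exI[of _ "{}"] exI[of _ "1::real"])
  then have "?c g \<in> topspace (wick_quot_topology p hbar)"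
    using quot(2) openin_subset by blast
  then have top: "g \<in> topspace (wick_topology p hbar)"
    using g by (simp add: wick_topology_def topspace_pullback_topology)
  have "eventually (\<lambda>i. f i \<in> U) G" if U: "openin (wick_topology p hbar) U" "g \<in> U" for U
  proof -
    obtain V where V: "wick_open p hbar V" "U = ?c -` V \<inter> wick_algebra p hbar"
      using U(1) by (auto simp: wick_topology_def openin_pullback_topology openin_wick_quot_topology)
    obtain e F where e: "0 < e" "finite F" "\<forall>(m, l, R, S)\<in>F. l < 2 ^ m" "wick_ball p hbar F e (?c g) \<subseteq> V"
    proof -
      have "?c g \<in> V" using V(2) U(2) by blast
      then show ?thesis
        using V(1) that unfolding wick_open_def by (elim conjE) (drule (1) bspec, elim exE conjE, blast)
    qed
    have "eventually (\<lambda>i. \<forall>(m, l, R, S)\<in>F. wick_norm p hbar m l R S (\<lambda>z. f i z - g z) < ennreal e) G"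
      using e by (intro eventually_ball_finite) (auto intro!: lim)
    then show ?thesis
    proof (rule eventually_mono)
      fix i assume "\<forall>(m, l, R, S)\<in>F. wick_norm p hbar m l R S (\<lambda>z. f i z - g z) < ennreal e"
      then have "?c (f i) \<in> wick_ball p hbar F e (?c g)"
        using quot(1) wick_dist_le[OF pre] by (fastforce simp: wick_ball_def intro: le_less_trans)
      then show "f i \<in> U" using e(4) V(2) f by blast
    qed
  qed
  with top show ?thesis by (simp add: limitin_def)
qed

theorem corollary5p9:
  fixes hbar t :: real and w p :: "complex^'n::finite"
  assumes "hbar > 0"
  shows "(\<forall>k. wick_power hbar (wick_J hbar w) k \<in> wick_algebra p hbar) \<and>
         limitin (wick_topology p hbar)
           (\<lambda>F z. \<Sum>k\<in>F. of_real (t ^ k / fact k) * wick_power hbar (wick_J hbar w) k z)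
           (wick_u hbar (t *\<^sub>R w))
           (finite_subsets_at_top (UNIV :: nat set))"
proof -
  let ?J = "wick_J hbar w" and ?a = "cdot w w / (2 * of_real hbar)" and ?t = "complex_of_real t"
  let ?G = "finite_subsets_at_top (UNIV :: nat set)"
  \<comment> \<open>Partial sums, limit and error as towers, with \<open>d\<close> the order of the
    derivative. The limit is a constant times an exponential and the error is a sum, to match the
    closure lemmas.\<close>
  let ?\<sigma> = "\<lambda>F d x. \<Sum>k\<in>F. ?t ^ k * hermite_tower ?a k d x"
  let ?\<omega> = "\<lambda>d x. exp (- (?a * ?t\<^sup>2 / 2)) * (?t ^ d * exp (?t * x))"
  let ?\<rho> = "\<lambda>F d x. ?\<sigma> F d x + (- 1) * ?\<omega> d x"
  have hbar: "hbar \<noteq> 0" using assms by simp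
  note J = bounded_linear_wick_J[of hbar w]
  have \<sigma>: "tower (?\<sigma> F)" for F
    by (intro tower_sum tower_cmult tower_hermite)
  have \<omega>: "tower ?\<omega>"
    by (intro tower_cmult tower_exp)
  have \<rho>: "tower (?\<rho> F)" for F
    by (intro tower_add[OF \<sigma> tower_cmult[OF \<omega>]])
  have \<omega>_eq: "?\<omega> d x = ?t ^ d * exp (?t * x - ?a * ?t\<^sup>2 / 2)" for d x
    by (simp add: exp_diff exp_minus field_simps)
  have pow: "wick_power hbar ?J k = (\<lambda>z. fact k * hermite_tower ?a k 0 (?J z))" for k
    by (simp add: wick_power_wick_J[OF hbar] hermite_tower_def)
  have partial: "(\<lambda>z. \<Sum>k\<in>F. of_real (t ^ k / fact k) * wick_power hbar ?J k z) = (\<lambda>z. ?\<sigma> F 0 (?J z))" for F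
    unfolding pow by (intro ext sum.cong) simp_all
  have u: "wick_u hbar (t *\<^sub>R w) = (\<lambda>z. ?\<omega> 0 (?J z))"
    unfolding \<omega>_eq using wick_u_eq[OF hbar, of t w] by auto
  obtain M where M: "0 \<le> M" "\<And>F d. finite F \<Longrightarrow>
      norm (?\<sigma> F d (?J p) - ?t ^ d * exp (?t * ?J p - ?a * ?t\<^sup>2 / 2))
        \<le> M * (2 - (\<Sum>k\<in>F. (1 / 2) ^ k)) * (2 * norm ?t) ^ d"
    using hermite_remainder[of ?t ?a "?J p"] by blast
  define \<epsilon> where "\<epsilon> F = M * (2 - (\<Sum>k\<in>F. (1 / 2) ^ k))" for F :: "nat set"
  \<comment> \<open>The geometric series is summed along the net of finite sets, so no order of
    summation enters.\<close>
  have "((\<lambda>F. \<Sum>k\<in>F. (1 / 2 :: real) ^ k) \<longlongrightarrow> 2) ?G"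
    using has_sum_geometric_half by (simp add: has_sum_def)
  then have \<epsilon>_lim: "(\<epsilon> \<longlongrightarrow> 0) ?G"
    unfolding \<epsilon>_def by (auto intro!: tendsto_eq_intros)
  have \<epsilon>_nonneg: "0 \<le> \<epsilon> F" if "finite F" for F
    using finite_sum_le_has_sum[OF has_sum_geometric_half that] M(1) by (auto simp: \<epsilon>_def)
  have "wick_power hbar ?J k \<in> wick_algebra p hbar" for k
    unfolding pow by (rule tower_in_wick_algebra[OF tower_cmult[OF tower_hermite] J assms])
  moreover have "limitin (wick_topology p hbar) (\<lambda>F z. ?\<sigma> F 0 (?J z)) (\<lambda>z. ?\<omega> 0 (?J z)) ?G"
  proof (rule limitin_wick_topologyI[OF tower_in_wick_algebra[OF \<sigma> J assms] tower_in_wick_algebra[OF \<omega> J assms]])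
    fix m l :: nat and R S :: "'n \<Rightarrow> nat" and e :: real
    assume "0 < e"
    \<comment> \<open>This rate is the same for all \<open>F\<close>, so one pair \<open>K\<close>,
      \<open>x\<close> serves all errors; only the factor \<open>\<epsilon> F\<close>
      varies.\<close>
    define r where "r = 2 * norm ?t * lin_bound ?J"
    have r: "0 \<le> r" by (simp add: r_def lin_bound_nonneg)
    obtain K x where K: "0 \<le> K" "0 \<le> x" and bound:
      "\<And>f C R S. 0 \<le> C \<Longrightarrow> (\<And>R S. cmod (mixed_deriv R S f p) \<le> C * r ^ (mi_size R + mi_size S)) \<Longrightarrow>
       wick_h p hbar m l R S f \<le> ennreal (C ^ 2 ^ (m + 1) * K * x ^ (mi_size R + mi_size S))"
      using wick_h_bound[OF assms r, of p m l] by blast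
    let ?b = "\<lambda>F. \<epsilon> F ^ 2 ^ (m + 1) * K * x ^ (mi_size R + mi_size S)"
    \<comment> \<open>The exponent \<open>2 ^ (m + 1)\<close> is positive, so the limit is
      0.\<close>
    have "(?b \<longlongrightarrow> 0 ^ 2 ^ (m + 1) * K * x ^ (mi_size R + mi_size S)) ?G"
      by (intro tendsto_intros \<epsilon>_lim)
    then have small: "eventually (\<lambda>F. ?b F < e ^ 2 ^ (m + 1)) ?G"
      using \<open>0 < e\<close> by (intro order_tendstoD(2)) (auto simp: power_0_left)
    have "eventually finite ?G"
      by (rule eventually_finite_subsets_at_top_weakI)
    with small show "eventually (\<lambda>F. wick_norm p hbar m l R S (\<lambda>z. ?\<sigma> F 0 (?J z) - ?\<omega> 0 (?J z)) < ennreal e) ?G"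
    proof (eventually_elim)
      case (elim F)
      then have F: "finite F" by simp
      have "norm (?\<rho> F d (?J p)) \<le> \<epsilon> F * (2 * norm ?t) ^ d" for d
        using M(2)[OF F, of d] unfolding \<omega>_eq \<epsilon>_def by simp
      then have "cmod (mixed_deriv R S (\<lambda>z. ?\<rho> F 0 (?J z)) p) \<le> \<epsilon> F * r ^ (mi_size R + mi_size S)" for R S
        unfolding r_def by (rule mixed_deriv_tower_bound[OF \<rho> J _ \<epsilon>_nonneg[OF F]]) simp
      then have "wick_h p hbar m l R S (\<lambda>z. ?\<rho> F 0 (?J z)) \<le> ennreal (?b F)"
        by (rule bound[OF \<epsilon>_nonneg[OF F]])
      then have "wick_norm p hbar m l R S (\<lambda>z. ?\<rho> F 0 (?J z)) < ennreal e"
        using elim(1) \<open>0 < e\<close> \<epsilon>_nonneg[OF F] K by (intro wick_norm_less) auto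
      then show ?case by simp
    qed
  qed
  ultimately show ?thesis
    unfolding partial u by blast
qed

end
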